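(* Let the standing assumptions in the context hold, suppose the Lasso block oracle problem has a unique solution for every weight vector $w\in\mathbb{R}^D_+$ with $w_{\mathcal{S}^c}=0$, let $\rho\ge0$, and suppose $$\Delta\ \ge\ (b_1+b_2)\tau .$$ Set $$C_\rho=\min\Big(\rho,\ \frac1{2^6}\sqrt{\frac{a_1}{a_0d_{\max}}},\ \frac{b_1}{b_1+b_2}\Big)(b_1+b_2)$$ and $$\delta_1^{op}=\mathbb{P}\big(\|\mathcal{L}(|\widehat\beta^{init}|-|\beta^*|)\|_{op}\ge C_\rho\tau\big),\qquad \delta_2^{op}=\mathbb{P}\Big(\sup_{\beta\in\mathcal{B}^{op}_{\rho,\tau}}\|\nabla_{\mathcal{S}^c}\ell(\beta)\|_{\max}>\frac{a_1\tau}{4d_{\max}}\Big),$$ $$\delta_3^{op}=\mathbb{P}\Big(\sup_{\beta\in\mathcal{B}^{op}_{\rho,\tau}}\|\mathcal{L}(|\beta|-|\beta^*|)\|_{op}\ge b_1\tau\Big).$$ Then the LLA algorithm initialized from $\widehat\beta^{init}$ converges to the block oracle $\widehat\beta^{o}$ in two steps with probability at least $1-\delta_1^{op}-\delta_2^{op}-\delta_3^{op}$. The same conclusion holds with probability at least $1-\delta_1^{F}-\delta_2^{F}-\delta_3^{F}$, where $$\delta_1^{F}=\mathbb{P}\Big(\min\big(\|\mathcal{L}(|\widehat\beta^{init}|-|\beta^*|)\|_F,\ K^{1/2}\|\mathcal{L}(|\widehat\beta^{init}|-|\beta^*|)\|_{op}\big)\ge C_\rho\tau\Big)$$ and $\delta_2^{F},\delta_3^{F}$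 are defined as $\delta_2^{op},\delta_3^{op}$ with $\mathcal{B}^{F}_{\rho,\tau}$ in place of $\mathcal{B}^{op}_{\rho,\tau}$.
   Context: Notation. $D=\binom d2$; vectors $x\in\mathbb{R}^D$ are indexed by unordered pairs $(ij)$, $i\ne j\in[d]$. $\mathcal{A}(x)\in\mathbb{R}^{d\times d}$ is the symmetric matrix with zero diagonal and entries $\mathcal{A}(x)_{ij}=x_{(ij)}$; $\mathcal{L}(x)=\mathrm{diag}(\mathcal{A}(x)\mathbf 1_d)-\mathcal{A}(x)$ is its Laplacian. $|x|$ is the entrywise absolute value, $\|x\|_{\max}=\max_\ell|x_\ell|$, $\|\cdot\|_{op}$ the spectral norm, $\|\cdot\|_F$ the Frobenius norm, and $\lambda_{(j)}$ the $j$-th smallest eigenvalue. The connected components of $x$ are those of the graph on $[d]$ with edge $ij$ iff $x_{(ij)}\neq0$ (isolated vertices count). SCAD-like penalty. Given $a_0\ge a_1>0$, $b_2>b_1>0$ and a tuning parameter $\tau$, $g_\tau:[0,\infty)\to\mathbb{R}$ satisfies: (1) $g_\tau$ is increasing and concave with $g_\tau(0)=0$; (2) $g_\tau$ is differentiable on $(0,\infty)$, and $g_\tau'(0):=g_\tau'(0+)=a_0\tau$; (3) $g_\tau'(t)\ge a_1\tau$ for $t\in(0,b_1\tau]$; (4) $g_\tau'(t)=0$ for $t\ge b_2\tau$. LLA step. For $V\in\mathbb{R}^{d\times m}$ and $w\in\mathbb{R}^m$ let $\mathcal{M}(V,w)_{(ij)}=\sum_k w_k(V_{ik}-V_{jk})^2$.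 An LLA step from $b$: let $V$ be an orthonormal matrix of eigenvectors of $\mathcal{L}(|b|)$ with eigenvalues $\lambda$, put $M=\mathcal{M}(V,g'_\tau(\lambda))$; the result is the minimizer over $\beta\in\mathbb{R}^D$ of $\ell(\beta)+\frac12\sum_{(ij)}M_{(ij)}|\beta_{(ij)}|$. The LLA algorithm iterates this step; it "converges to $\widehat\beta^{o}$ in two steps" if the second iterate, and all later ones, equal $\widehat\beta^{o}$. The loss $\ell$ and the initializer $\widehat\beta^{init}$ are random (functions of data). Target and oracle. $\beta^*\in\mathbb{R}^D$, $\beta^*\neq0$, is a fixed target; $K$ is its number of connected components (isolated vertices included), $d_{\max}$ the largest number of nodes in a component, $\mathcal{S}$ the set of pairs $(ij)$, $i\ne j$, in the same component, $\mathcal{S}^c$ its complement. The target gap is $\Delta=\lambda_{(K+1)}(\mathcal{L}(|\beta^*|))$. The block oracle $\widehat\beta^{o}$ is the minimizer of $\ell(\beta)$ subject to $\beta_{\mathcal{S}^c}=0$. Lasso block oracle problem with weight $w\in\mathbb{R}^D_+$, $w_{\mathcal{S}^c}=0$: minimize $\ell(\beta)+\frac12\sum_{(ij)\in\mathcal{S}}w_{(ij)}|\beta_{(ij)}|$ subject to $\beta_{\mathcal{S}^c}=0$. $\mathcal{B}^{op}_{\rho,\tau}$ is the set of all minimizers of this problem over weights $w\in\mathbb{R}^D_+$ with $w_{\mathcal{S}^c}=0$ and $\|w\|_{\max}\le 2^5a_0\tau\rho^2$. $\mathcal{B}^{F}_{\rho,\tau}$ is the set of all minimizers over weights $w\in\mathbb{R}^D_+$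 with $w_{\mathcal{S}^c}=0$, $\|w\|_{\max}\le2^5a_0\tau\rho^2$, $\|w\|_2\le2^{9/2}d_{\max}^{1/2}a_0\tau\rho^2$ and $\|w\|_1\le2^4d_{\max}a_0\tau\rho^2$. Standing assumptions. $\ell$ is convex (and differentiable); $g_\tau$ is SCAD-like, i.e. $g_\tau$ is increasing and concave on $[0,\infty)$ with $g_\tau(0)=0$, is differentiable on $(0,\infty)$ with $g_\tau'(0):=g_\tau'(0+)=a_0\tau$, and satisfies $g_\tau'(t)\ge a_1\tau$ for $t\in(0,b_1\tau]$ and $g_\tau'(t)=0$ for $t\ge b_2\tau$; and the block oracle problem has the unique solution $\widehat\beta^{o}$, which satisfies $\nabla_{\mathcal{S}}\ell(\widehat\beta^{o})=0$. *)

theory Defs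
  imports
    "HOL-Analysis.Analysis"
    "HOL-Probability.Probability"
    "HOL-Computational_Algebra.Polynomial"
    "HOL-Library.Cardinality"
begin

text \<open>The index set \<open>[d]\<close> is a finite type with at least two elements, so that \<open>real ^ 'd upair\<close>
  is the space of real vectors of dimension \<open>CARD('d) choose 2\<close>.\<close>

typedef ('d::card2) upair = "{e :: 'd set. card e = 2}"
proof -
  have "\<exists>e \<subseteq> (UNIV :: 'd set). card e = 2"
    using two_le_card[where 'a = 'd] by (meson obtain_subset_with_card_n)
  then show ?thesis by auto
qed

instance upair :: (card2) finite
proof
  have "(UNIV :: 'a upair set) = Abs_upair ` {e. card e = 2}"
    using type_definition.Abs_image[OF type_definition_upair] by auto
  then show "finite (UNIV :: 'a upair set)" by (metis finite finite_imageI)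
qed

lemma card_upair: "CARD('d::card2 upair) = CARD('d) choose 2"
proof -
  have "CARD('d upair) = card {e :: 'd set. card e = 2}"
    by (rule type_definition.card[OF type_definition_upair])
  then show ?thesis using n_subsets[of "UNIV :: 'd set" 2] by simp
qed

definition pair :: "'d::card2 \<Rightarrow> 'd \<Rightarrow> 'd upair" where
  "pair i j = Abs_upair {i, j}"

text \<open>\<open>pair i i\<close> is a junk value; \<open>pair\<close> is only used for distinct arguments.\<close>

lemma Rep_pair: "i \<noteq> j \<Longrightarrow> Rep_upair (pair i j) = {i, j}"
  by (simp add: pair_def Abs_upair_inverse)

lemma pair_commute: "pair i j = pair j i"
  by (simp add: pair_def insert_commute)

lemma pair_eq_iff:
  "i \<noteq> j \<Longrightarrow> k \<noteq> l \<Longrightarrow> pair i j = pair k l \<longleftrightarrow> (i = k \<and> j = l) \<or> (i = l \<and> j = k)"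
  by (metis Rep_pair doubleton_eq_iff pair_commute)

lemma pair_cases: obtains i j where "i \<noteq> j" "e = pair i j"
  by (metis (mono_tags, lifting) Rep_upair Rep_upair_inject Rep_pair card_2_iff mem_Collect_eq)

definition adj_matrix :: "real ^ ('d::card2) upair \<Rightarrow> real ^ ('d::card2) ^ ('d::card2)" where
  "adj_matrix x = (\<chi> i j. if i = j then 0 else x $ pair i j)"

definition diag_matrix :: "real ^ 'd \<Rightarrow> real ^ 'd ^ 'd" where
  "diag_matrix v = (\<chi> i j. if i = j then v $ i else 0)"

definition laplacian :: "real ^ ('d::card2) upair \<Rightarrow> real ^ ('d::card2) ^ ('d::card2)" where
  "laplacian x = diag_matrix (adj_matrix x *v 1) - adj_matrix x"

definition graph_components :: "real ^ ('d::card2) upair \<Rightarrow> 'd set set" where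
  "graph_components x = UNIV // {(i, j). i \<noteq> j \<and> x $ pair i j \<noteq> 0}\<^sup>*"

definition within_components :: "real ^ ('d::card2) upair \<Rightarrow> 'd upair set" where
  "within_components x = {e. \<exists>C \<in> graph_components x. Rep_upair e \<subseteq> C}"

definition op_norm :: "real ^ 'm ^ 'n \<Rightarrow> real" where
  "op_norm A = onorm (\<lambda>v. A *v v)"

text \<open>The Frobenius norm of a matrix is its \<^const>\<open>norm\<close>, and the maximum norm of a vector is its
  \<^const>\<open>infnorm\<close>.\<close>

lemma norm_eq_frobenius: "norm (A :: real ^ 'm ^ 'n) = sqrt (\<Sum>i\<in>UNIV. \<Sum>j\<in>UNIV. (A $ i $ j)\<^sup>2)"
  by (simp add: norm_vec_def L2_set_def sum_nonneg)

definition char_polynomial :: "real ^ 'd ^ 'd \<Rightarrow> real poly" where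
  "char_polynomial A = det (\<chi> i j. (if i = j then [:0, 1:] else 0) - [:A $ i $ j:])"

text \<open>The \<open>j\<close>-th smallest eigenvalue, counted from 1 and with multiplicity; meaningful for symmetric
  matrices, whose characteristic polynomial splits over the reals.\<close>

definition nth_eigenvalue :: "real ^ 'd ^ 'd \<Rightarrow> nat \<Rightarrow> real" where
  "nth_eigenvalue A j = sorted_list_of_multiset (proots (char_polynomial A)) ! (j - 1)"

definition orthonormal_eigensystem :: "real ^ 'd ^ 'd \<Rightarrow> real ^ 'd ^ 'd \<Rightarrow> real ^ 'd \<Rightarrow> bool" where
  "orthonormal_eigensystem A V lam \<longleftrightarrow>
     orthogonal_matrix V \<and> (\<forall>k. A *v column k V = lam $ k *\<^sub>R column k V)"

definition gradient :: "(real ^ 'e \<Rightarrow> real) \<Rightarrow> real ^ 'e \<Rightarrow> real ^ 'e" where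
  "gradient f x = (\<chi> e. frechet_derivative f (at x) (axis e 1))"

definition restrict_to :: "'e set \<Rightarrow> real ^ 'e \<Rightarrow> real ^ 'e" where
  "restrict_to T x = (\<chi> e. if e \<in> T then x $ e else 0)"

text \<open>Derivative of a penalty on \<open>[0,\<infinity>)\<close>, with its value at 0 defined as the limit from the right.\<close>

definition penalty_deriv :: "(real \<Rightarrow> real) \<Rightarrow> real \<Rightarrow> real" where
  "penalty_deriv g t = (if t = 0 then Lim (at_right 0) (deriv g) else deriv g t)"

definition SCAD_like ::
  "real \<Rightarrow> real \<Rightarrow> real \<Rightarrow> real \<Rightarrow> real \<Rightarrow> (real \<Rightarrow> real) \<Rightarrow> bool" where
  "SCAD_like a0 a1 b1 b2 \<tau> g \<longleftrightarrow>
     mono_on {0..} g \<and> concave_on {0..} g \<and> g 0 = 0 \<and>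
     (\<forall>t>0. g differentiable (at t)) \<and>
     (deriv g \<longlongrightarrow> a0 * \<tau>) (at_right 0) \<and>
     (\<forall>t. 0 < t \<and> t \<le> b1 * \<tau> \<longrightarrow> deriv g t \<ge> a1 * \<tau>) \<and>
     (\<forall>t>0. t \<ge> b2 * \<tau> \<longrightarrow> deriv g t = 0)"

text \<open>The defining expression is symmetric in \<open>i\<close> and \<open>j\<close>, so the description is proper.\<close>

definition pair_weights :: "real ^ 'm ^ ('d::card2) \<Rightarrow> real ^ 'm \<Rightarrow> real ^ 'd upair" where
  "pair_weights V w =
     (\<chi> e. THE y. \<exists>i j. i \<noteq> j \<and> e = pair i j \<and> y = (\<Sum>k\<in>UNIV. w $ k * (V $ i $ k - V $ j $ k)\<^sup>2))"

lemma pair_weights_pair: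
  assumes "i \<noteq> j"
  shows "pair_weights V w $ pair i j = (\<Sum>k\<in>UNIV. w $ k * (V $ i $ k - V $ j $ k)\<^sup>2)"
  unfolding pair_weights_def vec_lambda_beta
proof (rule the_equality)
  show "\<exists>i' j'. i' \<noteq> j' \<and> pair i j = pair i' j' \<and>
      (\<Sum>k\<in>UNIV. w $ k * (V $ i $ k - V $ j $ k)\<^sup>2) = (\<Sum>k\<in>UNIV. w $ k * (V $ i' $ k - V $ j' $ k)\<^sup>2)"
    using assms by blast
  show "y = (\<Sum>k\<in>UNIV. w $ k * (V $ i $ k - V $ j $ k)\<^sup>2)"
    if "\<exists>i' j'. i' \<noteq> j' \<and> pair i j = pair i' j' \<and>
      y = (\<Sum>k\<in>UNIV. w $ k * (V $ i' $ k - V $ j' $ k)\<^sup>2)" for y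
    using that assms by (auto simp: pair_eq_iff power2_commute)
qed

definition LLA_objective ::
  "(real ^ ('d::card2) upair \<Rightarrow> real) \<Rightarrow> (real \<Rightarrow> real) \<Rightarrow>
   real ^ ('d::card2) ^ ('d::card2) \<Rightarrow> real ^ ('d::card2) \<Rightarrow> real ^ 'd upair \<Rightarrow> real" where
  "LLA_objective loss g V lam \<beta> =
     loss \<beta> + 1/2 * (\<Sum>e\<in>UNIV. pair_weights V (\<chi> k. penalty_deriv g (lam $ k)) $ e * \<bar>\<beta> $ e\<bar>)"

text \<open>All results of an LLA step from \<open>b\<close>, over all orthonormal eigensystems and all minimizers.
  The step yields the vector \<open>\<beta>\<close> if it is the only possible result.\<close>

definition LLA_results ::
  "(real ^ ('d::card2) upair \<Rightarrow> real) \<Rightarrow> (real \<Rightarrow> real) \<Rightarrow> real ^ 'd upair \<Rightarrow> (real ^ 'd upair) set" where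
  "LLA_results loss g b =
     {\<beta>. \<exists>V lam. orthonormal_eigensystem (laplacian \<bar>b\<bar>) V lam \<and>
                 is_arg_min (LLA_objective loss g V lam) (\<lambda>_. True) \<beta>}"

definition LLA_step ::
  "(real ^ ('d::card2) upair \<Rightarrow> real) \<Rightarrow> (real \<Rightarrow> real) \<Rightarrow> real ^ 'd upair \<Rightarrow> real ^ 'd upair \<Rightarrow> bool" where
  "LLA_step loss g b \<beta> \<longleftrightarrow> LLA_results loss g b = {\<beta>}"

text \<open>Since \<^const>\<open>LLA_step\<close> is a partial function, the sequence of iterates is unique if it exists.\<close>

definition LLA_converges_in_two_steps ::
  "(real ^ ('d::card2) upair \<Rightarrow> real) \<Rightarrow> (real \<Rightarrow> real) \<Rightarrow> real ^ 'd upair \<Rightarrow> real ^ 'd upair \<Rightarrow> bool" where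
  "LLA_converges_in_two_steps loss g b \<beta> \<longleftrightarrow>
     (\<exists>it :: nat \<Rightarrow> real ^ 'd upair.
        it 0 = b \<and> (\<forall>t. LLA_step loss g (it t) (it (Suc t))) \<and> (\<forall>t\<ge>2. it t = \<beta>))"

definition supported_on :: "'e set \<Rightarrow> real ^ 'e \<Rightarrow> bool" where
  "supported_on S \<beta> \<longleftrightarrow> (\<forall>e. e \<notin> S \<longrightarrow> \<beta> $ e = 0)"

definition block_oracle :: "(real ^ 'e \<Rightarrow> real) \<Rightarrow> 'e set \<Rightarrow> real ^ 'e \<Rightarrow> bool" where
  "block_oracle loss S \<beta> \<longleftrightarrow> is_arg_min loss (supported_on S) \<beta>"

definition lasso_block_oracle ::
  "(real ^ 'e \<Rightarrow> real) \<Rightarrow> 'e set \<Rightarrow> real ^ 'e \<Rightarrow> real ^ 'e \<Rightarrow> bool" where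
  "lasso_block_oracle loss S w \<beta> \<longleftrightarrow>
     is_arg_min (\<lambda>\<beta>. loss \<beta> + 1/2 * (\<Sum>e\<in>S. w $ e * \<bar>\<beta> $ e\<bar>)) (supported_on S) \<beta>"

definition lasso_solutions_op ::
  "(real ^ 'e \<Rightarrow> real) \<Rightarrow> 'e set \<Rightarrow> real \<Rightarrow> real \<Rightarrow> real \<Rightarrow> (real ^ 'e) set" where
  "lasso_solutions_op loss S a0 \<rho> \<tau> =
     {\<beta>. \<exists>w \<ge> 0. supported_on S w \<and> infnorm w \<le> 2 ^ 5 * a0 * \<tau> * \<rho>\<^sup>2 \<and> lasso_block_oracle loss S w \<beta>}"

definition lasso_solutions_F ::
  "(real ^ 'e \<Rightarrow> real) \<Rightarrow> 'e set \<Rightarrow> nat \<Rightarrow> real \<Rightarrow> real \<Rightarrow> real \<Rightarrow> (real ^ 'e) set" where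
  "lasso_solutions_F loss S dmax a0 \<rho> \<tau> =
     {\<beta>. \<exists>w \<ge> 0. supported_on S w \<and> infnorm w \<le> 2 ^ 5 * a0 * \<tau> * \<rho>\<^sup>2 \<and>
                 norm w \<le> 2 powr (9/2) * sqrt (real dmax) * a0 * \<tau> * \<rho>\<^sup>2 \<and>
                 (\<Sum>e\<in>UNIV. \<bar>w $ e\<bar>) \<le> 2 ^ 4 * real dmax * a0 * \<tau> * \<rho>\<^sup>2 \<and>
                 lasso_block_oracle loss S w \<beta>}"

end

theory Submission
  imports Defs
begin

text \<open>
  Let \<open>Q\<close> be the orthogonal projection onto the vectors that are constant on the components of the
  target, and let \<open>L\<close> be the Laplacian of the absolute target. Then \<open>L\<close> vanishes on the range of
  \<open>Q\<close>, and its quadratic form is at least \<open>\<Delta> \<ge> (b1 + b2) * \<tau>\<close> on unit vectors of the orthogonal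
  complement (\<open>laplacian_gap\<close>). An LLA step from \<open>b\<close> uses an eigensystem \<open>(v\<^sub>k, \<lambda>\<^sub>k)\<close> of the
  perturbation \<open>L + E\<close>, where \<open>E\<close> is the Laplacian of \<open>\<bar>b\<bar> - \<bar>target\<bar>\<close>, and penalizes the pair
  \<open>(ij)\<close> with weight \<open>\<Sum>k. g'(\<lambda>\<^sub>k) * (v\<^sub>k \<bullet> (e\<^sub>i - e\<^sub>j))\<^sup>2\<close>.

  If \<open>\<epsilon>\<close>, the operator norm of \<open>E\<close>, is small against \<open>\<Delta>\<close>, every \<open>\<lambda>\<^sub>k\<close> is at most \<open>\<epsilon> < b1 * \<tau>\<close>
  or at least \<open>\<Delta> - \<epsilon> > b2 * \<tau>\<close>. The penalty derivative lies between \<open>a1 * \<tau>\<close> and \<open>a0 * \<tau>\<close> at the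
  former and vanishes at the latter, so the weight of \<open>(ij)\<close> is comparable to
  \<open>\<parallel>P (e\<^sub>i - e\<^sub>j)\<parallel>\<^sup>2\<close>, where \<open>P\<close> is the spectral projection of the small eigenvalues. In the manner of
  Davis and Kahan, \<open>P\<close> differs from \<open>Q\<close> by at most \<open>2 * \<epsilon> / \<Delta>\<close>. As \<open>Q (e\<^sub>i - e\<^sub>j)\<close> is zero inside
  a component and has squared norm at least \<open>2 / dmax\<close> between components, the weights are of order
  \<open>a0 * \<tau> * (\<epsilon> / \<Delta>)\<^sup>2\<close> inside components and exceed \<open>a1 * \<tau> / (2 * dmax)\<close> between them
  (\<open>LLA_weights_initial\<close>).

  First-order conditions for convex functions turn this into a statement about minimizers
  (\<open>lasso_block_solution_unique_minimizer\<close>): a solution of the Lasso block oracle problem whose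
  gradient between components is below half the weights there is the only minimizer of the full LLA
  objective. Outside the second bad event the solutions for all admissible weights have such small
  gradients. Hence the first step leads to the Lasso block oracle solution whose weights are those
  of the step inside components. This solution \<open>\<beta>\<close> is supported inside the components, so the Laplacian of \<open>\<bar>\<beta>\<bar>\<close>
  vanishes on the range of \<open>Q\<close>; outside the third bad event it is again a small perturbation of
  \<open>L\<close>, and together this forces \<open>P = Q\<close>. The weights inside components are then zero, and the second
  step gives the block oracle. The block oracle is itself the Lasso solution with zero weights, so
  the same reasoning shows that it is a fixed point.

  The Frobenius version needs in addition that the weights of the first step satisfy an \<open>\<ell>\<^sub>1\<close> and an
  \<open>\<ell>\<^sub>2\<close> bound. The \<open>\<ell>\<^sub>1\<close> norm is at most \<open>4 * dmax * a0 * \<tau>\<close> times \<open>\<parallel>P - Q P\<parallel>\<^sub>F\<^sup>2\<close>. A comparison of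
  traces replaces this Frobenius norm by that of \<open>Q - P Q\<close>, which is at most \<open>2 / \<Delta>\<close> times
  \<open>\<parallel>E Q\<parallel>\<^sub>F\<close>; and \<open>\<parallel>E Q\<parallel>\<^sub>F\<close> is bounded both by \<open>\<parallel>E\<parallel>\<^sub>F\<close> and, because \<open>Q\<close> has rank \<open>K\<close>, by \<open>sqrt K\<close>
  times the operator norm. The \<open>\<ell>\<^sub>2\<close> bound follows by interpolation between the maximum norm and the
  \<open>\<ell>\<^sub>1\<close> norm.
\<close>


section \<open>Eigensystems of real symmetric matrices\<close>

lemma symmetric_matrix_inner:
  fixes A :: "real ^ 'n ^ 'n"
  assumes "transpose A = A"
  shows "(A *v x) \<bullet> y = x \<bullet> (A *v y)"
  by (metis assms dot_lmul_matrix transpose_matrix_vector)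

text \<open>If \<open>A v\<close> were not zero, moving from \<open>v\<close> a small step against \<open>A v\<close> would make the quadratic form
  negative: its linear term is \<open>- 2 * s * \<parallel>A v\<parallel>\<^sup>2\<close>, and its remaining term is quadratic in \<open>s\<close>.\<close>

lemma psd_kernel:
  fixes A :: "real ^ 'n ^ 'n"
  assumes sym: "transpose A = A" and S: "subspace S" and inv: "\<And>x. x \<in> S \<Longrightarrow> A *v x \<in> S"
    and psd: "\<And>x. x \<in> S \<Longrightarrow> 0 \<le> x \<bullet> (A *v x)" and v: "v \<in> S" "v \<bullet> (A *v v) = 0"
  shows "A *v v = 0"
proof (rule ccontr)
  define w where "w = A *v v"
  define n where "n = w \<bullet> w"
  define c where "c = w \<bullet> (A *v w)"
  assume "A *v v \<noteq> 0"
  then have n: "n > 0" by (simp add: n_def w_def)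
  have w: "w \<in> S" using inv v by (simp add: w_def)
  have c: "c \<ge> 0" using psd w by (simp add: c_def)
  define s where "s = n / (c + 1)"
  have s: "s > 0" using n c by (simp add: s_def)
  have "v - s *\<^sub>R w \<in> S" using v w S by (simp add: subspace_diff subspace_scale)
  then have "0 \<le> (v - s *\<^sub>R w) \<bullet> (A *v (v - s *\<^sub>R w))" by (rule psd)
  also have "A *v (v - s *\<^sub>R w) = w - s *\<^sub>R (A *v w)"
    by (simp add: w_def matrix_vector_mult_diff_distrib matrix_vector_mult_scaleR)
  also have "(v - s *\<^sub>R w) \<bullet> \<dots> = v \<bullet> w - s * (v \<bullet> (A *v w)) - s * n + s * s * c"
    by (simp add: inner_diff_left inner_diff_right n_def c_def algebra_simps)
  also have "v \<bullet> (A *v w) = n"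
    using symmetric_matrix_inner[OF sym, of v w] by (simp add: n_def w_def)
  also have "v \<bullet> w = 0" using v(2) by (simp add: w_def)
  finally have "s * (2 * n) \<le> s * (s * c)" by (simp add: algebra_simps)
  then have "2 * n \<le> s * c" using s by simp
  also have "\<dots> \<le> n" using n c by (simp add: s_def divide_simps)
  finally show False using n by simp
qed

text \<open>The maximum \<open>lam\<close> of the quadratic form on the unit sphere of \<open>S\<close> exists by compactness. The matrix
  \<open>lam I - A\<close> is then positive semidefinite on \<open>S\<close> with a zero at the maximizer, so it kills the
  maximizer.\<close>

lemma invariant_subspace_eigenvector:
  fixes A :: "real ^ 'n ^ 'n"
  assumes sym: "transpose A = A" and S: "subspace S" and inv: "\<And>x. x \<in> S \<Longrightarrow> A *v x \<in> S"
    and ne: "S \<noteq> {0}"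
  obtains v lam where "v \<in> S" "norm v = 1" "A *v v = lam *\<^sub>R v"
proof -
  obtain u where u: "u \<in> S" "u \<noteq> 0" using ne S subspace_0 by blast
  let ?K = "S \<inter> sphere 0 1"
  have "compact ?K" using S closed_subspace compact_Int_closed[of "sphere 0 1" S]
    by (auto simp: Int_commute)
  moreover have "u /\<^sub>R norm u \<in> ?K" using u S by (simp add: subspace_scale)
  moreover have "continuous_on ?K (\<lambda>x. x \<bullet> (A *v x))"
    by (intro continuous_intros linear_continuous_on) auto
  ultimately have "\<exists>v\<in>?K. \<forall>x\<in>?K. x \<bullet> (A *v x) \<le> v \<bullet> (A *v v)"
    by (intro continuous_attains_sup) auto
  then obtain v where v: "v \<in> ?K" and
    max: "\<And>x. x \<in> ?K \<Longrightarrow> x \<bullet> (A *v x) \<le> v \<bullet> (A *v v)" by blast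
  define lam where "lam = v \<bullet> (A *v v)"
  define B where "B = lam *\<^sub>R mat 1 - A"
  have B: "B *v x = lam *\<^sub>R x - A *v x" for x
    by (simp add: B_def matrix_vector_mult_diff_rdistrib scaleR_matrix_vector_assoc[symmetric])
  have "transpose B = B"
    using sym by (simp add: B_def transpose_def mat_def vec_eq_iff)
  moreover have "B *v x \<in> S" if "x \<in> S" for x
    using that inv S by (simp add: B subspace_diff subspace_scale)
  moreover have "0 \<le> x \<bullet> (B *v x)" if x: "x \<in> S" for x
  proof (cases "x = 0")
    case False
    have "x /\<^sub>R norm x \<in> ?K" using x False S by (simp add: subspace_scale)
    from max[OF this] have "(x \<bullet> (A *v x)) / (norm x)\<^sup>2 \<le> lam"
      by (simp add: lam_def matrix_vector_mult_scaleR power2_eq_square divide_simps)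
    then show ?thesis using False
      by (simp add: B inner_diff_right divide_simps power2_norm_eq_inner)
  qed simp
  moreover have "v \<bullet> (B *v v) = 0"
    using v by (simp add: B inner_diff_right lam_def dot_square_norm)
  ultimately have "B *v v = 0" using psd_kernel[of B S v] S v by auto
  then show ?thesis using that[of v lam] v by (simp add: B)
qed

text \<open>Split off one eigenvector at a time: the vectors of \<open>S\<close> orthogonal to it form an invariant subspace
  of smaller dimension.\<close>

lemma invariant_subspace_eigenbasis:
  fixes A :: "real ^ 'n ^ 'n"
  assumes sym: "transpose A = A" and S: "subspace S" and inv: "\<And>x. x \<in> S \<Longrightarrow> A *v x \<in> S"
  shows "\<exists>B \<subseteq> S. pairwise orthogonal B \<and> (\<forall>v\<in>B. norm v = 1 \<and> (\<exists>lam. A *v v = lam *\<^sub>R v)) \<and> span B = S"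
  using S inv
proof (induction "dim S" arbitrary: S rule: less_induct)
  case less
  show ?case
  proof (cases "S = {0}")
    case True
    then show ?thesis by (intro exI[of _ "{}"]) auto
  next
    case False
    from invariant_subspace_eigenvector[OF sym less.prems False]
    obtain v lam where v: "v \<in> S" "norm v = 1" "A *v v = lam *\<^sub>R v" .
    let ?T = "{x \<in> S. v \<bullet> x = 0}"
    have T: "subspace ?T" using less.prems(1) by (auto simp: subspace_def inner_add_right)
    have "v \<notin> ?T" using v(2) by auto
    then have "?T \<subset> S" using v(1) by blast
    then have "dim ?T < dim S"
      using T less.prems(1) by (intro dim_psubset) (simp add: span_eq_iff[THEN iffD2])
    moreover have "A *v x \<in> ?T" if "x \<in> ?T" for x
      using that less.prems(2) symmetric_matrix_inner[OF sym, of v x] v(3) by auto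
    ultimately obtain B where B: "B \<subseteq> ?T" "pairwise orthogonal B" "span B = ?T"
        "\<forall>v\<in>B. norm v = 1 \<and> (\<exists>lam. A *v v = lam *\<^sub>R v)"
      using less.hyps[of ?T] T by auto
    have "pairwise orthogonal (insert v B)"
      using B by (auto simp: pairwise_insert orthogonal_def inner_commute)
    moreover have "x \<in> span (insert v B)" if x: "x \<in> S" for x
    proof -
      have "x - (v \<bullet> x) *\<^sub>R v \<in> ?T"
        using x v less.prems(1)
        by (simp add: subspace_diff subspace_scale inner_diff_right dot_square_norm)
      then show ?thesis using B(3) by (auto simp: span_insert)
    qed
    moreover have "span (insert v B) \<subseteq> S"
      using B(1) v(1) less.prems(1) by (intro span_minimal) auto
    ultimately show ?thesis
      using B v by (intro exI[of _ "insert v B"]) auto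
  qed
qed

theorem symmetric_matrix_eigensystem:
  fixes A :: "real ^ 'n ^ 'n"
  assumes sym: "transpose A = A"
  shows "\<exists>V lam. orthonormal_eigensystem A V lam"
proof -
  obtain B where B: "pairwise orthogonal B" "span B = (UNIV :: (real ^ 'n) set)"
      "\<forall>v\<in>B. norm v = 1 \<and> (\<exists>lam. A *v v = lam *\<^sub>R v)"
    using invariant_subspace_eigenbasis[OF sym, of UNIV] by auto
  have indep: "independent B" using B by (intro pairwise_orthogonal_independent) auto
  then have "finite B" "card B = CARD('n)"
    using B(2) by (auto simp: independent_imp_finite basis_card_eq_dim[of B UNIV])
  then obtain b where b: "bij_betw b (UNIV :: 'n set) B"
    using bij_betw_iff_card[of "UNIV :: 'n set" B] by auto
  from B(3) obtain ev where ev: "\<And>v. v \<in> B \<Longrightarrow> A *v v = ev v *\<^sub>R v" by metis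
  define V :: "real ^ 'n ^ 'n" where "V = (\<chi> i k. b k $ i)"
  have col: "column k V = b k" for k by (simp add: V_def column_def vec_eq_iff)
  have bB: "b k \<in> B" for k using b by (auto simp: bij_betw_def)
  have "orthogonal_matrix V"
    using B b bB by (auto simp: orthogonal_matrix_orthonormal_columns col pairwise_def bij_betw_def inj_eq)
  then have "orthonormal_eigensystem A V (\<chi> k. ev (b k))"
    using ev bB by (auto simp: orthonormal_eigensystem_def col)
  then show ?thesis by blast
qed

section \<open>Ordered eigenvalues and spectral functions\<close>

lemma transpose_mult_mult_eq_inner: "(transpose W ** B ** W) $ i $ j = column i W \<bullet> (B *v column j W)"
  for W B :: "real ^ 'n ^ 'n"
proof -
  have "(transpose W ** (B ** W)) $ i $ j = column i W \<bullet> column j (B ** W)"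
    by (simp add: matrix_matrix_mult_def transpose_def column_def inner_vec_def)
  also have "column j (B ** W) = B *v column j W"
    by (metis matrix_vector_mul_assoc matrix_vector_mult_basis)
  finally show ?thesis by (simp add: matrix_mul_assoc)
qed

context
  fixes A V :: "real ^ 'n ^ 'n" and lam :: "real ^ 'n"
  assumes es: "orthonormal_eigensystem A V lam"
begin

lemma eigensystem_inner: "column j V \<bullet> column k V = (if j = k then 1 else 0)"
  using es by (auto simp: orthonormal_eigensystem_def orthogonal_matrix_orthonormal_columns
      orthogonal_def dot_square_norm)

lemma eigensystem_eigenvector: "A *v column k V = lam $ k *\<^sub>R column k V"
  using es by (simp add: orthonormal_eigensystem_def)

lemma eigensystem_expansion: "(\<Sum>k\<in>UNIV. (column k V \<bullet> x) *\<^sub>R column k V) = x"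
proof -
  have "x = V *v (transpose V *v x)"
    using es by (simp add: orthonormal_eigensystem_def orthogonal_matrix_def matrix_vector_mul_assoc
        del: transpose_matrix_vector)
  also have "\<dots> = (\<Sum>k\<in>UNIV. (transpose V *v x) $ k *s column k V)"
    by (rule matrix_mult_sum)
  also have "\<dots> = (\<Sum>k\<in>UNIV. (column k V \<bullet> x) *\<^sub>R column k V)"
    by (intro sum.cong)
      (auto simp: matrix_vector_mult_def transpose_def column_def inner_vec_def vec_eq_iff)
  finally show ?thesis ..
qed

lemma eigensystem_parseval: "x \<bullet> y = (\<Sum>k\<in>UNIV. (column k V \<bullet> x) * (column k V \<bullet> y))"
proof -
  have "x \<bullet> y = (\<Sum>k\<in>UNIV. (column k V \<bullet> x) *\<^sub>R column k V) \<bullet> y"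
    by (simp only: eigensystem_expansion)
  also have "\<dots> = (\<Sum>k\<in>UNIV. (column k V \<bullet> x) * (column k V \<bullet> y))"
    by (simp add: inner_sum_left)
  finally show ?thesis .
qed

lemma eigensystem_norm: "(norm x)\<^sup>2 = (\<Sum>k\<in>UNIV. (column k V \<bullet> x)\<^sup>2)"
  by (simp add: power2_norm_eq_inner eigensystem_parseval[of x x] flip: power2_eq_square)

lemma eigensystem_inner_mult:
  assumes "transpose A = A"
  shows "column k V \<bullet> (A *v x) = lam $ k * (column k V \<bullet> x)"
  using symmetric_matrix_inner[OF assms, of "column k V" x] by (simp add: eigensystem_eigenvector)

text \<open>Both sides have the same values: conjugation with \<open>V\<close> turns \<open>x I - A\<close> into a diagonal matrix
  without changing its determinant.\<close>

lemma char_polynomial_eigensystem: "char_polynomial A = (\<Prod>k\<in>UNIV. [:- lam $ k, 1:])"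
proof -
  have "poly (char_polynomial A) x = poly (\<Prod>k\<in>UNIV. [:- lam $ k, 1:]) x" for x
  proof -
    let ?B = "x *\<^sub>R mat 1 - A"
    have B: "?B *v u = x *\<^sub>R u - A *v u" for u
      by (simp add: matrix_vector_mult_diff_rdistrib scaleR_matrix_vector_assoc[symmetric])
    have "poly (char_polynomial A) x = det ?B"
      by (simp add: char_polynomial_def det_def poly_sum poly_prod mat_def)
        (intro sum.cong refl arg_cong2[where f = "(*)"] prod.cong, auto)
    also have "\<dots> = det (transpose V ** ?B ** V)"
    proof -
      have "det (transpose V) * det V = 1"
        using es by (metis orthonormal_eigensystem_def orthogonal_matrix_def det_mul det_I)
      then show ?thesis by (simp add: det_mul mult_ac)
    qed
    also have "\<dots> = (\<Prod>k\<in>UNIV. x - lam $ k)"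
      by (subst det_diagonal)
        (auto simp: transpose_mult_mult_eq_inner B inner_diff_right eigensystem_eigenvector
          eigensystem_inner)
    also have "\<dots> = poly (\<Prod>k\<in>UNIV. [:- lam $ k, 1:]) x"
      by (simp add: poly_prod)
    finally show ?thesis .
  qed
  then show ?thesis by (simp add: poly_eq_poly_eq_iff[symmetric] fun_eq_iff)
qed

text \<open>This is how the definition of the ordered eigenvalues by the characteristic polynomial becomes usable
  for an eigensystem: in the sorted list of roots, an entry smaller than the one at position \<open>m\<close>
  (counted from 0) stands before it. The bound on \<open>m\<close> keeps this position inside the list.\<close>

lemma card_eigenvalues_below_nth:
  assumes "m < CARD('n)"
  shows "card {k. lam $ k < nth_eigenvalue A (m + 1)} \<le> m"
proof -
  define X where "X = image_mset (($) lam) (mset_set UNIV)"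
  define xs where "xs = sorted_list_of_multiset X"
  have "(\<Sum>k\<in>T. {#lam $ k#}) = image_mset (($) lam) (mset_set T)" for T
    by (induction T rule: infinite_finite_induct) auto
  then have "(\<Sum>k\<in>UNIV. {#lam $ k#}) = X" by (simp add: X_def)
  then have X: "proots (char_polynomial A) = X"
    by (simp add: char_polynomial_eigensystem proots_prod)
  define t where "t = nth_eigenvalue A (m + 1)"
  have t: "t = xs ! m" by (simp add: t_def nth_eigenvalue_def xs_def X)
  have len: "m < length xs"
    using assms by (simp add: xs_def X_def flip: size_mset)
  have "card {k. lam $ k < t} = size (filter_mset (\<lambda>x. x < t) X)"
    by (simp add: X_def filter_mset_image_mset)
  also have "\<dots> = length (filter (\<lambda>x. x < t) xs)"
    by (metis mset_filter mset_sorted_list_of_multiset size_mset xs_def)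
  also have "\<dots> = card {i. i < length xs \<and> xs ! i < t}" by (rule length_filter_conv_card)
  also have "\<dots> \<le> card {..<m}"
  proof (intro card_mono subsetI)
    fix i assume i: "i \<in> {i. i < length xs \<and> xs ! i < t}"
    have "\<not> m \<le> i"
      using i t len sorted_nth_mono[of xs m i] by (auto simp: xs_def)
    then show "i \<in> {..<m}" by simp
  qed simp
  finally show ?thesis by (simp add: t_def)
qed

end

text \<open>The quadratic form of \<open>f(A)\<close> depends on \<open>A\<close> only. Eigenvectors of two eigensystems overlap only if
  their eigenvalues agree, so \<open>f\<close> can be moved from one index to the other in the double sum.\<close>

lemma functional_calculus_unique:
  fixes A :: "real ^ 'n ^ 'n"
  assumes sym: "transpose A = A"
    and V: "orthonormal_eigensystem A V lam" and W: "orthonormal_eigensystem A W mu"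
  shows "(\<Sum>k\<in>UNIV. f (lam $ k) * (column k V \<bullet> x)\<^sup>2) = (\<Sum>k\<in>UNIV. f (mu $ k) * (column k W \<bullet> x)\<^sup>2)"
proof -
  let ?v = "\<lambda>k. column k V" and ?w = "\<lambda>k. column k W"
  have overlap: "f (lam $ k) * (?v k \<bullet> ?w l) = f (mu $ l) * (?v k \<bullet> ?w l)" for k l
  proof -
    have "lam $ k * (?v k \<bullet> ?w l) = mu $ l * (?v k \<bullet> ?w l)"
      using eigensystem_inner_mult[OF V sym, of k "?w l"] by (auto simp: eigensystem_eigenvector[OF W])
    then show ?thesis by (cases "?v k \<bullet> ?w l = 0") auto
  qed
  have "(\<Sum>k\<in>UNIV. f (lam $ k) * (?v k \<bullet> x)\<^sup>2)
      = (\<Sum>k\<in>UNIV. f (lam $ k) * (?v k \<bullet> x) * (\<Sum>l\<in>UNIV. (?w l \<bullet> ?v k) * (?w l \<bullet> x)))"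
    by (simp add: power2_eq_square mult.assoc flip: eigensystem_parseval[OF W])
  also have "\<dots> = (\<Sum>k\<in>UNIV. \<Sum>l\<in>UNIV. (f (lam $ k) * (?v k \<bullet> ?w l)) * (?v k \<bullet> x) * (?w l \<bullet> x))"
    by (simp add: sum_distrib_left inner_commute mult_ac)
  also have "\<dots> = (\<Sum>l\<in>UNIV. \<Sum>k\<in>UNIV. f (mu $ l) * (?w l \<bullet> x) * ((?v k \<bullet> ?w l) * (?v k \<bullet> x)))"
    unfolding overlap by (subst sum.swap) (simp add: mult_ac)
  also have "\<dots> = (\<Sum>l\<in>UNIV. f (mu $ l) * (?w l \<bullet> x)\<^sup>2)"
    by (simp add: power2_eq_square mult.assoc flip: sum_distrib_left eigensystem_parseval[OF V])
  finally show ?thesis .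
qed

lemma pair_weights_eq_inner:
  assumes "i \<noteq> j"
  shows "pair_weights V w $ pair i j = (\<Sum>k\<in>UNIV. w $ k * (column k V \<bullet> (axis i 1 - axis j 1))\<^sup>2)"
  by (simp add: pair_weights_pair[OF assms] inner_diff_right inner_axis column_def)

text \<open>A step of the algorithm has a unique result only because its weights do not depend on the chosen
  eigensystem, which is not unique when eigenvalues coincide.\<close>

lemma pair_weights_unique:
  assumes "transpose A = A" "orthonormal_eigensystem A V lam" "orthonormal_eigensystem A W mu"
  shows "pair_weights V (\<chi> k. f (lam $ k)) = pair_weights W (\<chi> k. f (mu $ k))"
proof -
  have "pair_weights V (\<chi> k. f (lam $ k)) $ e = pair_weights W (\<chi> k. f (mu $ k)) $ e" for e
  proof (cases e rule: pair_cases)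
    case (1 i j)
    then show ?thesis using functional_calculus_unique[OF assms] by (simp add: pair_weights_eq_inner)
  qed
  then show ?thesis by (simp add: vec_eq_iff)
qed

section \<open>Orthogonal projections and the spectral gap\<close>

definition orth_projection :: "real ^ 'n ^ 'n \<Rightarrow> bool" where
  "orth_projection P \<longleftrightarrow> transpose P = P \<and> P ** P = P"

definition spectral_projection :: "real ^ 'n ^ 'n \<Rightarrow> 'n set \<Rightarrow> real ^ 'n ^ 'n" where
  "spectral_projection V T = (\<chi> i j. \<Sum>k\<in>T. V $ i $ k * V $ j $ k)"

lemma orth_projection_idem:
  assumes "orth_projection P"
  shows "P *v (P *v x) = P *v x"
  using assms by (simp add: orth_projection_def matrix_vector_mul_assoc)

lemma orth_projection_inner:
  assumes "orth_projection P"
  shows "(P *v x) \<bullet> y = x \<bullet> (P *v y)"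
  using assms by (simp add: orth_projection_def symmetric_matrix_inner)

lemma orth_projection_norm:
  assumes "orth_projection P"
  shows "(norm (P *v x))\<^sup>2 = x \<bullet> (P *v x)"
  by (simp add: assms orth_projection_idem orth_projection_inner power2_norm_eq_inner)

lemma orth_projection_pythagoras:
  assumes "orth_projection P"
  shows "(norm x)\<^sup>2 = (norm (P *v x))\<^sup>2 + (norm (x - P *v x))\<^sup>2"
  using orth_projection_inner[OF assms, of x x]
  by (simp add: assms orth_projection_idem orth_projection_inner power2_norm_eq_inner
      inner_diff_left inner_diff_right inner_commute)

lemma orth_projection_norm_le:
  assumes "orth_projection P"
  shows "norm (P *v x) \<le> norm x" "norm (x - P *v x) \<le> norm x"
  by (rule power2_le_imp_le; simp add: orth_projection_pythagoras[OF assms, of x])+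

lemma orth_projection_diff:
  assumes "orth_projection P"
  shows "P *v (x - P *v x) = 0"
  by (simp add: matrix_vector_mult_diff_distrib orth_projection_idem[OF assms])

lemma frobenius_eq_trace: "(norm A)\<^sup>2 = trace (transpose A ** A)" for A :: "real ^ 'n ^ 'm"
proof -
  have "(norm A)\<^sup>2 = (\<Sum>i\<in>UNIV. \<Sum>j\<in>UNIV. (A $ i $ j)\<^sup>2)"
    unfolding norm_eq_frobenius by (simp add: sum_nonneg)
  also have "\<dots> = (\<Sum>j\<in>UNIV. \<Sum>i\<in>UNIV. (A $ i $ j)\<^sup>2)" by (rule sum.swap)
  finally show ?thesis
    by (simp add: trace_def matrix_matrix_mult_def transpose_def power2_eq_square)
qed

lemma matrix_diff_mult_distrib:
  fixes A B C :: "real ^ 'n ^ 'n"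
  shows "(A - B) ** C = A ** C - B ** C" "A ** (B - C) = A ** B - A ** C"
  by (simp_all add: matrix_matrix_mult_def vec_eq_iff algebra_simps sum_subtractf)

lemma frobenius_projection_residual:
  assumes P: "orth_projection P" and Q: "orth_projection Q"
  shows "(norm (P - Q ** P))\<^sup>2 = trace P - trace (P ** Q)"
proof -
  have t: "transpose P = P" "transpose Q = Q" "P ** P = P" "Q ** Q = Q"
    using P Q by (auto simp: orth_projection_def)
  have "transpose (P - Q ** P) = transpose P - transpose (Q ** P)"
    by (simp add: transpose_def vec_eq_iff)
  then have tr: "transpose (P - Q ** P) = P - P ** Q"
    by (simp add: matrix_transpose_mul t)
  have "(P - P ** Q) ** (P - Q ** P) = P - P ** Q ** P"
    by (simp add: matrix_diff_mult_distrib t matrix_mul_assoc)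
      (simp add: t flip: matrix_mul_assoc)
  moreover have "trace (P ** Q ** P) = trace (P ** Q)"
    by (metis matrix_mul_assoc t(3) trace_mul_sym)
  ultimately show ?thesis by (simp add: frobenius_eq_trace tr trace_sub)
qed

text \<open>Both residuals have a squared norm of the form trace minus \<open>trace (P ** Q)\<close>. The rule exchanges the
  two projections in a Frobenius bound at the price of the difference of their ranks.\<close>

lemma frobenius_projection_swap:
  assumes P: "orth_projection P" and Q: "orth_projection Q"
  shows "(norm (P - Q ** P))\<^sup>2 = (norm (Q - P ** Q))\<^sup>2 + trace P - trace Q"
  using frobenius_projection_residual[OF P Q] frobenius_projection_residual[OF Q P]
    trace_mul_sym[of P Q] by simp

text \<open>A projection that contains the range of another one and is not larger in rank equals it: the
  Frobenius norm of the other residual is then at most zero.\<close>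

lemma orth_projection_eqI:
  assumes P: "orth_projection P" and Q: "orth_projection Q"
    and sub: "\<And>u. P *v (Q *v u) = Q *v u" and tr: "trace P \<le> trace Q"
  shows "P = Q"
proof -
  have QP: "P ** Q = Q" by (simp add: matrix_eq sub flip: matrix_vector_mul_assoc)
  then have "(norm (P - Q ** P))\<^sup>2 \<le> 0"
    using frobenius_projection_swap[OF P Q] tr by simp
  then have "P = Q ** P" by simp
  moreover have "Q ** P = Q"
    using arg_cong[OF QP, of transpose] P Q by (simp add: matrix_transpose_mul orth_projection_def)
  ultimately show ?thesis by simp
qed

lemma spectral_projection_mult:
  "spectral_projection V T *v x = (\<Sum>k\<in>T. (column k V \<bullet> x) *\<^sub>R column k V)"
  by (simp add: vec_eq_iff spectral_projection_def matrix_vector_mult_def column_def inner_vec_def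
      sum_component sum_distrib_left sum_distrib_right mult_ac)
    (auto intro: sum.swap)

lemma spectral_projection_quadratic:
  "x \<bullet> (spectral_projection V T *v x) = (\<Sum>k\<in>T. (column k V \<bullet> x)\<^sup>2)"
  by (simp add: spectral_projection_mult inner_sum_right power2_eq_square inner_commute)

context
  fixes A V :: "real ^ 'n ^ 'n" and lam :: "real ^ 'n"
  assumes es: "orthonormal_eigensystem A V lam"
begin

lemma inner_spectral_projection:
  "column k V \<bullet> (spectral_projection V T *v x) = (if k \<in> T then column k V \<bullet> x else 0)"
  by (simp add: spectral_projection_mult inner_sum_right eigensystem_inner[OF es]
      if_distrib[of "(*) _"] cong: if_cong)

lemma orth_projection_spectral: "orth_projection (spectral_projection V T)"
proof -
  have "spectral_projection V T *v (spectral_projection V T *v x) = spectral_projection V T *v x" for x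
    by (subst (1) spectral_projection_mult, simp add: inner_spectral_projection)
      (simp add: spectral_projection_mult)
  then have "spectral_projection V T ** spectral_projection V T = spectral_projection V T"
    by (simp add: matrix_eq flip: matrix_vector_mul_assoc)
  moreover have "transpose (spectral_projection V T) = spectral_projection V T"
    by (simp add: spectral_projection_def transpose_def mult.commute)
  ultimately show ?thesis by (simp add: orth_projection_def)
qed

lemma trace_spectral_projection: "trace (spectral_projection V T) = real (card T)"
proof -
  have "trace (spectral_projection V T) = (\<Sum>k\<in>T. column k V \<bullet> column k V)"
    by (simp add: trace_def spectral_projection_def column_def inner_vec_def)
      (rule sum.swap)
  then show ?thesis by (simp add: eigensystem_inner[OF es])
qed

lemma range_spectral_projection:
  "range ((*v) (spectral_projection V T)) = span ((\<lambda>k. column k V) ` T)"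
proof
  show "range ((*v) (spectral_projection V T)) \<subseteq> span ((\<lambda>k. column k V) ` T)"
    by (auto simp: spectral_projection_mult intro: span_sum span_scale span_base)
  have "column j V \<in> range ((*v) (spectral_projection V T))" if "j \<in> T" for j
  proof
    show "column j V = spectral_projection V T *v column j V"
      using that by (simp add: spectral_projection_mult eigensystem_inner[OF es]
          if_distrib[of "\<lambda>a. a *\<^sub>R _"] cong: if_cong)
  qed simp
  moreover have "subspace (range ((*v) (spectral_projection V T)))"
    by (intro linear_subspace_image) auto
  ultimately show "span ((\<lambda>k. column k V) ` T) \<subseteq> range ((*v) (spectral_projection V T))"
    by (intro span_minimal) auto
qed

lemma dim_range_spectral_projection: "dim (range ((*v) (spectral_projection V T))) = card T"
proof -
  have inj: "inj_on (\<lambda>k. column k V) T"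
    by (rule inj_onI) (metis eigensystem_inner[OF es] zero_neq_one)
  have "pairwise orthogonal ((\<lambda>k. column k V) ` T)"
    by (auto simp: pairwise_def orthogonal_def eigensystem_inner[OF es])
  moreover have "column k V \<noteq> 0" for k
    by (metis eigensystem_inner[OF es] inner_zero_left zero_neq_one)
  ultimately have "independent ((\<lambda>k. column k V) ` T)"
    by (intro pairwise_orthogonal_independent) (auto simp: image_iff)
  then show ?thesis
    by (simp add: range_spectral_projection dim_eq_card_independent card_image inj)
qed

end

text \<open>The eigenvalues of a projection are 0 and 1, so it is the spectral projection of its eigenvalue 1, and
  both its trace and the dimension of its range count this eigenvalue.\<close>

lemma trace_orth_projection:
  assumes P: "orth_projection P"
  shows "trace P = real (dim (range ((*v) P)))"
proof -
  have sym: "transpose P = P" using P by (simp add: orth_projection_def)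
  obtain V lam where es: "orthonormal_eigensystem P V lam"
    using symmetric_matrix_eigensystem[OF sym] by blast
  have lam: "lam $ k = 0 \<or> lam $ k = 1" for k
    using eigensystem_inner_mult[OF es sym, of k "P *v column k V"]
    by (simp add: orth_projection_idem[OF P])
      (simp add: eigensystem_eigenvector[OF es] eigensystem_inner[OF es])
  define T where "T = {k. lam $ k = 1}"
  have "P *v x = spectral_projection V T *v x" for x
  proof -
    have "P *v x = (\<Sum>k\<in>UNIV. (column k V \<bullet> (P *v x)) *\<^sub>R column k V)"
      by (simp add: eigensystem_expansion[OF es])
    also have "\<dots> = (\<Sum>k\<in>T. (column k V \<bullet> x) *\<^sub>R column k V)"
      using lam by (intro sum.mono_neutral_cong_right)
        (auto simp: T_def eigensystem_inner_mult[OF es sym])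
    finally show ?thesis by (simp add: spectral_projection_mult)
  qed
  then have "P = spectral_projection V T" by (simp add: matrix_eq)
  then show ?thesis by (simp add: trace_spectral_projection[OF es] dim_range_spectral_projection[OF es])
qed

text \<open>The hypothesis says that \<open>Q\<close> is injective on the range of \<open>P\<close>, which bounds the rank of \<open>P\<close>.\<close>

lemma trace_orth_projection_mono:
  assumes P: "orth_projection P" and Q: "orth_projection Q"
    and inj: "\<And>u. P *v u = u \<Longrightarrow> Q *v u = 0 \<Longrightarrow> u = 0"
  shows "trace P \<le> trace Q"
proof -
  have sub: "subspace (range ((*v) P))" by (intro linear_subspace_image) auto
  have "inj_on ((*v) Q) (span (range ((*v) P)))"
  proof (rule inj_onI)
    fix x y assume "x \<in> span (range ((*v) P))" "y \<in> span (range ((*v) P))" and eq: "Q *v x = Q *v y"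
    then have "P *v x = x" "P *v y = y"
      using sub orth_projection_idem[OF P] by (auto simp: span_eq_iff[THEN iffD2])
    then show "x = y"
      using inj[of "x - y"] eq by (simp add: matrix_vector_mult_diff_distrib)
  qed
  then have "dim (range ((*v) P)) = dim ((*v) Q ` range ((*v) P))"
    by (intro dim_image_eq[symmetric]) auto
  also have "\<dots> \<le> dim (range ((*v) Q))" by (intro dim_subset) auto
  finally show ?thesis by (simp add: trace_orth_projection P Q)
qed

text \<open>At most \<open>m\<close> eigenvalues are below \<open>D\<close>, and their eigenvectors span a space that contains the range
  of \<open>Q\<close>, a part of the kernel. As \<open>Q\<close> has rank \<open>m\<close>, the two spaces coincide, and a vector orthogonal
  to them has only components with eigenvalue at least \<open>D\<close>.\<close>

theorem spectral_gap_quadratic_form: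
  fixes A Q :: "real ^ 'n ^ 'n"
  assumes sym: "transpose A = A" and Q: "orth_projection Q"
    and ker: "\<And>u. A *v (Q *v u) = 0" and tr: "trace Q = real m" and m: "m < CARD('n)"
    and D: "D > 0" "D \<le> nth_eigenvalue A (m + 1)" and u: "Q *v u = 0"
  shows "D * (norm u)\<^sup>2 \<le> u \<bullet> (A *v u)"
proof -
  obtain V lam where es: "orthonormal_eigensystem A V lam"
    using symmetric_matrix_eigensystem[OF sym] by blast
  define Z where "Z = {k. lam $ k < D}"
  have "card Z \<le> card {k. lam $ k < nth_eigenvalue A (m + 1)}"
    using D by (intro card_mono) (auto simp: Z_def)
  also have "\<dots> \<le> m" by (rule card_eigenvalues_below_nth[OF es m])
  finally have cardZ: "card Z \<le> m" .
  have "spectral_projection V Z *v (Q *v x) = Q *v x" for x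
  proof -
    have "column k V \<bullet> (Q *v x) = 0" if "k \<notin> Z" for k
      using eigensystem_inner_mult[OF es sym, of k "Q *v x"] that D by (auto simp: ker Z_def)
    then have "spectral_projection V Z *v (Q *v x) = (\<Sum>k\<in>UNIV. (column k V \<bullet> (Q *v x)) *\<^sub>R column k V)"
      unfolding spectral_projection_mult by (intro sum.mono_neutral_left) auto
    then show ?thesis by (simp add: eigensystem_expansion[OF es])
  qed
  then have "spectral_projection V Z = Q"
    using cardZ by (intro orth_projection_eqI orth_projection_spectral[OF es] Q)
      (auto simp: trace_spectral_projection[OF es] tr)
  then have zero: "column k V \<bullet> u = 0" if "k \<in> Z" for k
    using inner_spectral_projection[OF es, of k Z u] u that by simp
  have "D * (norm u)\<^sup>2 = (\<Sum>k\<in>UNIV. D * (column k V \<bullet> u)\<^sup>2)"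
    by (simp only: eigensystem_norm[OF es] sum_distrib_left)
  also have "\<dots> \<le> (\<Sum>k\<in>UNIV. lam $ k * (column k V \<bullet> u)\<^sup>2)"
  proof (rule sum_mono)
    fix k
    show "D * (column k V \<bullet> u)\<^sup>2 \<le> lam $ k * (column k V \<bullet> u)\<^sup>2"
      using zero[of k] by (cases "k \<in> Z") (auto simp: Z_def intro: mult_right_mono)
  qed
  also have "\<dots> = u \<bullet> (A *v u)"
    by (simp add: eigensystem_parseval[OF es, of u "A *v u"] eigensystem_inner_mult[OF es sym]
        power2_eq_square mult_ac)
  finally show ?thesis .
qed

section \<open>Graph Laplacians and connected components\<close>

lemma abs_vec_component: "\<bar>x\<bar> $ e = \<bar>x $ e\<bar>" for x :: "real ^ 'e"
  by (simp add: abs_vec_def)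

lemma laplacian_diff: "laplacian (x - y) = laplacian x - laplacian y"
  by (simp add: laplacian_def diag_matrix_def adj_matrix_def matrix_vector_mult_def vec_eq_iff
      flip: sum_subtractf) (auto intro: sum.cong)

lemma transpose_laplacian: "transpose (laplacian x) = laplacian x"
  by (simp add: laplacian_def diag_matrix_def adj_matrix_def transpose_def vec_eq_iff pair_commute)

lemma laplacian_mult:
  fixes x :: "real ^ ('d::card2) upair"
  shows "(laplacian x *v u) $ i = (\<Sum>j\<in>UNIV. adj_matrix x $ i $ j * (u $ i - u $ j))"
proof -
  have "(diag_matrix v *v u) $ i = v $ i * u $ i" for v :: "real ^ ('d::card2)"
    by (simp add: diag_matrix_def matrix_vector_mult_def if_distrib[of "\<lambda>a. a * _"] cong: if_cong)
  then show ?thesis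
    by (simp add: laplacian_def matrix_vector_mult_diff_rdistrib)
      (simp add: matrix_vector_mult_def sum_subtractf sum_distrib_right right_diff_distrib)
qed

lemma laplacian_quadratic_form:
  "u \<bullet> (laplacian x *v u)
     = 1/2 * (\<Sum>i\<in>UNIV. \<Sum>j\<in>UNIV. adj_matrix x $ i $ j * (u $ i - u $ j)\<^sup>2)"
proof -
  let ?a = "\<lambda>i j. adj_matrix x $ i $ j"
  have sym: "?a i j = ?a j i" for i j by (simp add: adj_matrix_def pair_commute)
  have 1: "u \<bullet> (laplacian x *v u) = (\<Sum>i\<in>UNIV. \<Sum>j\<in>UNIV. ?a i j * (u $ i * (u $ i - u $ j)))"
    by (simp add: inner_vec_def laplacian_mult sum_distrib_left mult_ac)
  also have "\<dots> = (\<Sum>i\<in>UNIV. \<Sum>j\<in>UNIV. ?a j i * (u $ j * (u $ j - u $ i)))"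
    by (rule sum.swap)
  finally have 2: "u \<bullet> (laplacian x *v u) = (\<Sum>i\<in>UNIV. \<Sum>j\<in>UNIV. ?a i j * (u $ j * (u $ j - u $ i)))"
    by (simp only: sym)
  have "2 * (u \<bullet> (laplacian x *v u))
      = (\<Sum>i\<in>UNIV. \<Sum>j\<in>UNIV. ?a i j * (u $ i * (u $ i - u $ j)) + ?a i j * (u $ j * (u $ j - u $ i)))"
    using 1 2 by (simp add: sum.distrib)
  also have "\<dots> = (\<Sum>i\<in>UNIV. \<Sum>j\<in>UNIV. ?a i j * (u $ i - u $ j)\<^sup>2)"
    by (intro sum.cong refl) (simp add: power2_eq_square algebra_simps)
  finally show ?thesis by simp
qed

lemma laplacian_abs_psd: "0 \<le> u \<bullet> (laplacian \<bar>x\<bar> *v u)"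
  unfolding laplacian_quadratic_form
  by (intro mult_nonneg_nonneg sum_nonneg) (auto simp: adj_matrix_def abs_vec_component)

definition component :: "real ^ ('d::card2) upair \<Rightarrow> 'd \<Rightarrow> 'd set" where
  "component x i = {(i, j). i \<noteq> j \<and> x $ pair i j \<noteq> 0}\<^sup>* `` {i}"

lemma self_in_component: "i \<in> component x i"
  by (simp add: component_def)

lemma component_nonempty: "component x i \<noteq> {}"
  using self_in_component[of i x] by blast

lemma component_sym: "j \<in> component x i \<longleftrightarrow> i \<in> component x j"
proof -
  have "sym {(i, j). i \<noteq> j \<and> x $ pair i j \<noteq> 0}" by (auto simp: sym_def pair_commute)
  then have "sym ({(i, j). i \<noteq> j \<and> x $ pair i j \<noteq> 0}\<^sup>*)" by (rule sym_rtrancl)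
  then show ?thesis by (auto simp: component_def dest: symD)
qed

lemma component_eq: "j \<in> component x i \<Longrightarrow> component x j = component x i"
  using component_sym[of j x i] by (auto simp: component_def intro: rtrancl_trans)

lemma component_eq_iff: "component x j = component x i \<longleftrightarrow> j \<in> component x i"
  using component_eq self_in_component by blast

lemma graph_components_eq: "graph_components x = range (component x)"
  by (auto simp: graph_components_def component_def quotient_def)

lemma pair_in_within_components:
  assumes "i \<noteq> j"
  shows "pair i j \<in> within_components x \<longleftrightarrow> j \<in> component x i"
proof -
  have "(\<exists>k. i \<in> component x k \<and> j \<in> component x k) \<longleftrightarrow> j \<in> component x i"
    using component_eq[of i x] self_in_component[of i x] by blast
  then show ?thesis using assms by (simp add: within_components_def graph_components_eq Rep_pair)
qed

lemma supported_on_within_components: "supported_on (within_components x) x"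
  unfolding supported_on_def
proof (intro allI impI)
  fix e assume e: "e \<notin> within_components x"
  obtain i j where ij: "i \<noteq> j" "e = pair i j" by (rule pair_cases)
  then show "x $ e = 0" using e by (auto simp: pair_in_within_components component_def)
qed

lemma card_component_le: "card (component x i) \<le> Max (card ` graph_components x)"
  by (rule Max_ge) (auto simp: graph_components_eq)

lemma card_component_pos: "card (component x i) > 0"
  using self_in_component[of i x] by (auto simp: card_gt_0_iff)

text \<open>An edge makes two vertices share a component. The strict bound ensures that there is an eigenvalue
  number \<open>K + 1\<close>.\<close>

lemma card_graph_components_less:
  fixes x :: "real ^ ('d::card2) upair"
  assumes "x \<noteq> 0"
  shows "card (graph_components x) < CARD('d)"
proof -
  from assms obtain e where e: "x $ e \<noteq> 0" by (auto simp: vec_eq_iff)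
  obtain i j where ij: "i \<noteq> j" "e = pair i j" by (rule pair_cases)
  then have "j \<in> component x i" using e by (auto simp: component_def)
  then have "component x i = component x j" by (simp add: component_eq)
  then have "range (component x) = component x ` (UNIV - {i})"
    using ij(1) by auto
  then have "card (graph_components x) \<le> card (UNIV - {i})"
    using card_image_le[of "UNIV - {i}" "component x"] by (simp add: graph_components_eq)
  also have "\<dots> < CARD('d)" by (intro psubset_card_mono) auto
  finally show ?thesis .
qed

text \<open>Averaging over components: the orthogonal projection onto the vectors that are constant on each
  component.\<close>

definition component_projection :: "real ^ ('d::card2) upair \<Rightarrow> real ^ ('d::card2) ^ ('d::card2)" where
  "component_projection x =
     (\<chi> i j. if j \<in> component x i then 1 / real (card (component x i)) else 0)"

lemma component_projection_mult:
  "(component_projection x *v u) $ i = (\<Sum>j\<in>component x i. u $ j) / real (card (component x i))"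
  by (simp add: component_projection_def matrix_vector_mult_def if_distrib[of "\<lambda>a. a * _"]
      sum.If_cases sum_divide_distrib cong: if_cong)

lemma component_projection_constant:
  "j \<in> component x i \<Longrightarrow> (component_projection x *v u) $ j = (component_projection x *v u) $ i"
  by (simp add: component_projection_mult component_eq)

lemma component_projection_fixes:
  assumes "\<And>i j. j \<in> component x i \<Longrightarrow> u $ j = u $ i"
  shows "component_projection x *v u = u"
proof -
  have "(\<Sum>j\<in>component x i. u $ j) = real (card (component x i)) * u $ i" for i
    using assms by (simp add: sum.cong[where h = "\<lambda>_. u $ i", OF refl])
  then show ?thesis
    by (simp add: vec_eq_iff component_projection_mult component_nonempty)
qed

lemma orth_component_projection: "orth_projection (component_projection x)"
proof -
  have "component_projection x *v (component_projection x *v u) = component_projection x *v u" for u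
    by (intro component_projection_fixes component_projection_constant)
  then have "component_projection x ** component_projection x = component_projection x"
    by (simp add: matrix_eq flip: matrix_vector_mul_assoc)
  moreover have "transpose (component_projection x) = component_projection x"
    using component_sym component_eq
    by (fastforce simp: component_projection_def transpose_def vec_eq_iff)
  ultimately show ?thesis by (simp add: orth_projection_def)
qed

text \<open>Each vertex contributes the inverse size of its component, so each component contributes one.\<close>

lemma trace_component_projection: "trace (component_projection x) = real (card (graph_components x))"
proof -
  have "trace (component_projection x) = (\<Sum>i\<in>UNIV. 1 / real (card (component x i)))"
    by (simp add: trace_def component_projection_def self_in_component)
  also have "\<dots> = (\<Sum>C\<in>range (component x). \<Sum>i\<in>{i \<in> UNIV. component x i = C}. 1 / real (card (component x i)))"
    by (rule sum.image_gen) simp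
  also have "\<dots> = (\<Sum>C\<in>range (component x). 1)"
  proof (rule sum.cong[OF refl])
    fix C assume "C \<in> range (component x)"
    then obtain c where c: "C = component x c" by blast
    then have "{i \<in> UNIV. component x i = C} = C" by (auto simp: component_eq_iff)
    then show "(\<Sum>i\<in>{i \<in> UNIV. component x i = C}. 1 / real (card (component x i))) = 1"
      by (simp add: component_nonempty c component_eq sum.cong[where h = "\<lambda>_. 1 / real (card (component x c))"])
  qed
  finally show ?thesis by (simp add: graph_components_eq)
qed

text \<open>An edge of \<open>b\<close> joins vertices of the same component of \<open>x\<close>, where the averaged vector takes equal
  values.\<close>

lemma laplacian_component_projection:
  assumes "supported_on (within_components x) b"
  shows "laplacian \<bar>b\<bar> *v (component_projection x *v u) = 0"
proof -
  let ?w = "component_projection x *v u"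
  have "adj_matrix \<bar>b\<bar> $ i $ j * (?w $ i - ?w $ j) = 0" for i j
  proof (cases "i \<noteq> j \<and> j \<notin> component x i")
    case True
    then show ?thesis using assms
      by (simp add: adj_matrix_def abs_vec_component supported_on_def pair_in_within_components)
  next
    case False
    then show ?thesis using component_projection_constant[of j x i u] by auto
  qed
  then show ?thesis by (auto simp: vec_eq_iff laplacian_mult intro!: sum.neutral)
qed

lemma component_projection_edge_within:
  assumes "j \<in> component x i"
  shows "component_projection x *v (axis i 1 - axis j 1) = 0"
proof -
  have "i \<in> component x k \<longleftrightarrow> j \<in> component x k" for k
    using assms component_eq_iff[of x] by metis
  then show ?thesis
    by (simp add: vec_eq_iff component_projection_mult sum_subtractf axis_def)
qed

text \<open>The squared norm is the sum of the inverse sizes of the two components.\<close>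

lemma component_projection_edge_between:
  assumes ij: "j \<notin> component x i"
  shows "2 / real (Max (card ` graph_components x))
      \<le> (norm (component_projection x *v (axis i 1 - axis j 1)))\<^sup>2"
proof -
  have inv: "1 / real (Max (card ` graph_components x)) \<le> 1 / real (card (component x k))" for k
    using card_component_le[of x k] card_component_pos[of x k] by (intro divide_left_mono) auto
  have "(norm (component_projection x *v (axis i 1 - axis j 1)))\<^sup>2
      = (axis i 1 - axis j 1) \<bullet> (component_projection x *v (axis i 1 - axis j 1))"
    by (rule orth_projection_norm[OF orth_component_projection])
  also have "\<dots> = 1 / real (card (component x i)) + 1 / real (card (component x j))"
    using ij component_sym[of i x j]
    by (simp add: inner_diff_left inner_axis')
      (simp add: component_projection_mult sum_subtractf axis_def self_in_component)
  finally show ?thesis using inv[of i] inv[of j] by simp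
qed

lemma norm_edge_vector: "i \<noteq> j \<Longrightarrow> (norm (axis i 1 - axis j 1 :: real ^ 'n))\<^sup>2 = 2"
  by (simp add: power2_norm_eq_inner inner_diff_left inner_diff_right inner_axis_axis)

text \<open>Each vertex \<open>i\<close> occurs in fewer than \<open>dmax\<close> pairs inside its component. The factor 2 comes from
  counting ordered pairs; the constants of the final theorem leave room for it.\<close>

lemma sum_within_components_le:
  fixes x :: "real ^ ('d::card2) upair"
  assumes h: "\<And>e. e \<in> within_components x \<Longrightarrow> 0 \<le> h e"
    and bound: "\<And>i j. i \<noteq> j \<Longrightarrow> j \<in> component x i \<Longrightarrow> h (pair i j) \<le> n i + n j"
    and n: "\<And>i. 0 \<le> (n i :: real)"
  shows "sum h (within_components x) \<le> 2 * real (Max (card ` graph_components x)) * sum n UNIV"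
proof -
  let ?I = "{(i, j). i \<noteq> j \<and> j \<in> component x i}"
  let ?d = "real (Max (card ` graph_components x))"
  have "within_components x = case_prod pair ` ?I"
  proof
    show "within_components x \<subseteq> case_prod pair ` ?I"
    proof
      fix e assume "e \<in> within_components x"
      then show "e \<in> case_prod pair ` ?I"
        by (cases e rule: pair_cases) (auto simp: pair_in_within_components)
    qed
  qed (auto simp: pair_in_within_components)
  then have "sum h (within_components x) \<le> (\<Sum>(i, j)\<in>?I. h (pair i j))"
    using sum_image_le[of ?I h "case_prod pair"] h by (auto simp: o_def case_prod_unfold)
  also have "\<dots> \<le> (\<Sum>(i, j)\<in>?I. n i + n j)"
    using bound by (intro sum_mono) auto
  also have "\<dots> \<le> (\<Sum>(i, j)\<in>Sigma UNIV (component x). n i + n j)"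
    using n by (intro sum_mono2) (auto intro: add_nonneg_nonneg)
  also have "\<dots> = (\<Sum>i\<in>UNIV. \<Sum>j\<in>component x i. n i) + (\<Sum>i\<in>UNIV. \<Sum>j\<in>component x i. n j)"
    by (simp add: sum.Sigma[symmetric] sum.distrib)
  also have "(\<Sum>i\<in>UNIV. \<Sum>j\<in>component x i. n j) = (\<Sum>j\<in>UNIV. \<Sum>i\<in>component x j. n j)"
  proof -
    have "{i. j \<in> component x i} = component x j" for j using component_sym[of j x] by blast
    then show ?thesis
      using sum.swap_restrict[of UNIV UNIV "\<lambda>i j. n j" "\<lambda>i j. j \<in> component x i"] by simp
  qed
  also have "(\<Sum>i\<in>UNIV. \<Sum>j\<in>component x i. n i) + \<dots> \<le> (\<Sum>i\<in>UNIV. ?d * n i) + (\<Sum>i\<in>UNIV. ?d * n i)"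
    using n card_component_le[of x] by (intro add_mono sum_mono) (auto intro!: mult_right_mono)
  finally show ?thesis by (simp add: sum_distrib_left mult.assoc)
qed

section \<open>Perturbation of the kernel of a symmetric matrix\<close>

text \<open>The setting is a symmetric matrix \<open>A0\<close> that vanishes on the range of \<open>Q\<close> and has quadratic form at
  least \<open>D\<close> on its complement, together with a symmetric perturbation \<open>E\<close> of size at most \<open>eps\<close>.\<close>

context
  fixes A0 E Q V :: "real ^ 'n ^ 'n" and lam :: "real ^ 'n" and D eps :: real
  assumes es: "orthonormal_eigensystem (A0 + E) V lam"
    and sym: "transpose A0 = A0" "transpose E = E"
    and Q: "orth_projection Q" and ker: "\<And>u. A0 *v (Q *v u) = 0"
    and gap: "\<And>u. Q *v u = 0 \<Longrightarrow> D * (norm u)\<^sup>2 \<le> u \<bullet> (A0 *v u)"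
    and E: "\<And>u. norm (E *v u) \<le> eps * norm u" and eps: "0 \<le> eps" "eps < D"
begin

lemma transpose_perturbed: "transpose (A0 + E) = A0 + E"
  using sym by (simp add: transpose_def vec_eq_iff)

text \<open>A unit eigenvector \<open>x\<close> for \<open>lam\<close> satisfies \<open>A0 x = lam x - E x\<close>. Comparing the parts in the range
  of \<open>Q\<close> and in its complement gives \<open>lam * \<parallel>Q x\<parallel> \<le> \<parallel>Q E x\<parallel>\<close> and
  \<open>(D - lam) * \<parallel>x - Q x\<parallel> \<le> \<parallel>E x - Q E x\<parallel>\<close>. If both factors exceeded \<open>eps\<close>, the two right-hand sides
  together would have a squared norm larger than \<open>eps\<^sup>2\<close>.\<close>

lemma perturbed_eigenvalue_dichotomy: "lam $ k \<le> eps \<or> D - eps \<le> lam $ k"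
proof (rule ccontr)
  assume "\<not> ?thesis"
  then have lam: "eps < lam $ k" "eps < D - lam $ k" by auto
  define x where "x = column k V"
  define y where "y = x - Q *v x"
  have nx: "norm x = 1"
    using eigensystem_inner[OF es, of k k] by (simp add: x_def norm_eq_1)
  have A0x: "A0 *v x = lam $ k *\<^sub>R x - E *v x"
    using eigensystem_eigenvector[OF es, of k]
    by (simp add: x_def matrix_vector_mult_add_rdistrib algebra_simps)
  have A0y: "A0 *v y = A0 *v x" by (simp add: y_def matrix_vector_mult_diff_distrib ker)
  have Qy: "Q *v y = 0" by (simp add: y_def orth_projection_diff[OF Q])
  have "Q *v (A0 *v x) = 0"
  proof -
    have "(Q *v (A0 *v x)) \<bullet> z = 0" for z
      using symmetric_matrix_inner[OF sym(1), of x "Q *v z"]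
      by (simp add: orth_projection_inner[OF Q] ker)
    then show ?thesis using inner_eq_zero_iff by blast
  qed
  then have QE: "Q *v (E *v x) = lam $ k *\<^sub>R (Q *v x)"
    by (simp add: A0x matrix_vector_mult_diff_distrib matrix_vector_mult_scaleR)
  have "y \<bullet> (A0 *v y) = lam $ k * (norm y)\<^sup>2 - y \<bullet> (E *v x - Q *v (E *v x))"
  proof -
    have "y \<bullet> x = (norm y)\<^sup>2"
      using orth_projection_inner[OF Q, of y x] Qy
      by (simp add: y_def power2_norm_eq_inner inner_diff_right)
    moreover have "y \<bullet> (Q *v (E *v x)) = 0"
      using orth_projection_inner[OF Q, of y "E *v x"] Qy by simp
    ultimately show ?thesis by (simp add: A0y A0x inner_diff_right)
  qed
  then have "(D - lam $ k) * (norm y)\<^sup>2 \<le> - (y \<bullet> (E *v x - Q *v (E *v x)))"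
    using gap[OF Qy] by (simp add: algebra_simps)
  also have "\<dots> \<le> norm y * norm (E *v x - Q *v (E *v x))"
    using Cauchy_Schwarz_ineq2[of y "E *v x - Q *v (E *v x)"] by linarith
  finally have "norm y * ((D - lam $ k) * norm y) \<le> norm y * norm (E *v x - Q *v (E *v x))"
    by (simp add: power2_eq_square mult_ac)
  then have y: "(D - lam $ k) * norm y \<le> norm (E *v x - Q *v (E *v x))"
    by (cases "norm y = 0") auto
  define m where "m = min (lam $ k) (D - lam $ k)"
  have m: "eps < m" "m \<le> lam $ k" "m \<le> D - lam $ k" using lam by (auto simp: m_def)
  have "m\<^sup>2 = (m * norm (Q *v x))\<^sup>2 + (m * norm y)\<^sup>2"
    using orth_projection_pythagoras[OF Q, of x] nx
    by (simp add: y_def power_mult_distrib flip: distrib_left)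
  also have "\<dots> \<le> (norm (Q *v (E *v x)))\<^sup>2 + (norm (E *v x - Q *v (E *v x)))\<^sup>2"
  proof (intro add_mono power_mono)
    show "m * norm (Q *v x) \<le> norm (Q *v (E *v x))"
      using m eps by (simp add: QE mult_right_mono)
    show "m * norm y \<le> norm (E *v x - Q *v (E *v x))"
      using mult_right_mono[OF m(3), of "norm y"] y by simp
  qed (use m eps in auto)
  also have "\<dots> = (norm (E *v x))\<^sup>2" by (rule orth_projection_pythagoras[OF Q, symmetric])
  also have "\<dots> \<le> eps\<^sup>2" using E[of x] nx by (intro power_mono) auto
  finally show False using m eps power2_le_imp_le[of m eps] by simp
qed

text \<open>On the range of \<open>P\<close> both the perturbed matrix and the perturbation have size at most \<open>eps\<close>, so
  \<open>A0\<close> maps a vector \<open>x\<close> of it to one of norm at most \<open>2 * eps * \<parallel>x\<parallel>\<close>, whereas \<open>A0\<close> expands the part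
  of \<open>x\<close> outside the range of \<open>Q\<close> by at least \<open>D\<close>.\<close>

lemma small_eigenspace_near_kernel:
  assumes lam: "\<And>k. 0 \<le> lam $ k" and P: "P = spectral_projection V {k. lam $ k \<le> eps}"
  shows "norm (P *v u - Q *v (P *v u)) \<le> 2 * eps / D * norm (P *v u)"
proof -
  define x where "x = P *v u"
  define y where "y = x - Q *v x"
  have "(norm ((A0 + E) *v x))\<^sup>2 = (\<Sum>k\<in>UNIV. (lam $ k * (column k V \<bullet> x))\<^sup>2)"
    by (simp only: eigensystem_norm[OF es] eigensystem_inner_mult[OF es transpose_perturbed])
  also have "\<dots> \<le> (\<Sum>k\<in>UNIV. (eps * (column k V \<bullet> x))\<^sup>2)"
  proof (rule sum_mono)
    fix k
    show "(lam $ k * (column k V \<bullet> x))\<^sup>2 \<le> (eps * (column k V \<bullet> x))\<^sup>2"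
    proof (cases "lam $ k \<le> eps")
      case True
      then have "(lam $ k)\<^sup>2 \<le> eps\<^sup>2" using lam[of k] by (intro power_mono)
      then show ?thesis unfolding power_mult_distrib by (rule mult_right_mono) simp
    next
      case False
      then have "column k V \<bullet> x = 0" by (simp add: x_def P inner_spectral_projection[OF es])
      then show ?thesis by simp
    qed
  qed
  also have "\<dots> = (eps * norm x)\<^sup>2"
    by (simp only: power_mult_distrib eigensystem_norm[OF es] sum_distrib_left)
  finally have Ax: "norm ((A0 + E) *v x) \<le> eps * norm x"
    by (rule power2_le_imp_le) (simp add: eps)
  have "A0 *v y = (A0 + E) *v x - E *v x"
    by (simp add: y_def matrix_vector_mult_diff_distrib matrix_vector_mult_add_rdistrib ker)
  then have A0y: "norm (A0 *v y) \<le> 2 * eps * norm x"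
    using Ax E[of x] norm_triangle_ineq4[of "(A0 + E) *v x" "E *v x"] by simp
  have "D * (norm y)\<^sup>2 \<le> y \<bullet> (A0 *v y)"
    by (rule gap) (simp add: y_def orth_projection_diff[OF Q])
  also have "\<dots> \<le> norm y * norm (A0 *v y)" by (rule norm_cauchy_schwarz)
  also have "\<dots> \<le> norm y * (2 * eps * norm x)" using A0y by (rule mult_left_mono) simp
  finally have "norm y * (D * norm y) \<le> norm y * (2 * eps * norm x)"
    by (simp add: power2_eq_square mult_ac)
  then have "D * norm y \<le> 2 * eps * norm x"
    using eps by (cases "norm y = 0") auto
  then show ?thesis using eps by (simp add: x_def y_def field_simps)
qed

text \<open>The converse direction: on \<open>x = Q u\<close> the perturbed matrix acts as \<open>E\<close> alone, while it is at least
  \<open>D - eps\<close> on the part of \<open>x\<close> outside the range of \<open>P\<close>. The bound is kept in terms of \<open>E (Q u)\<close>,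
  because its sum over an orthonormal basis is what a Frobenius bound needs.\<close>

lemma kernel_near_small_eigenspace:
  assumes P: "P = spectral_projection V {k. lam $ k \<le> eps}"
  shows "norm (Q *v u - P *v (Q *v u)) \<le> norm (E *v (Q *v u)) / (D - eps)"
proof -
  define x where "x = Q *v u"
  define y where "y = x - P *v x"
  have yk: "column k V \<bullet> y = (if lam $ k \<le> eps then 0 else column k V \<bullet> x)" for k
    by (simp add: y_def P inner_diff_right inner_spectral_projection[OF es])
  have "(D - eps) * (norm y)\<^sup>2 = (\<Sum>k\<in>UNIV. (D - eps) * (column k V \<bullet> y)\<^sup>2)"
    by (simp only: eigensystem_norm[OF es] sum_distrib_left)
  also have "\<dots> \<le> (\<Sum>k\<in>UNIV. (column k V \<bullet> y) * (column k V \<bullet> ((A0 + E) *v x)))"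
  proof (rule sum_mono)
    fix k
    show "(D - eps) * (column k V \<bullet> y)\<^sup>2 \<le> (column k V \<bullet> y) * (column k V \<bullet> ((A0 + E) *v x))"
    proof (cases "lam $ k \<le> eps")
      case False
      then have "D - eps \<le> lam $ k" using perturbed_eigenvalue_dichotomy[of k] by auto
      then have "(D - eps) * (column k V \<bullet> x)\<^sup>2 \<le> lam $ k * (column k V \<bullet> x)\<^sup>2"
        by (rule mult_right_mono) simp
      then show ?thesis using False
        by (simp add: yk eigensystem_inner_mult[OF es] transpose_perturbed power2_eq_square mult_ac)
    qed (simp add: yk)
  qed
  also have "\<dots> = y \<bullet> ((A0 + E) *v x)" by (rule eigensystem_parseval[OF es, symmetric])
  also have "(A0 + E) *v x = E *v x" by (simp add: x_def matrix_vector_mult_add_rdistrib ker)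
  also have "y \<bullet> (E *v x) \<le> norm y * norm (E *v x)" by (rule norm_cauchy_schwarz)
  finally have "norm y * ((D - eps) * norm y) \<le> norm y * norm (E *v x)"
    by (simp add: power2_eq_square mult_ac)
  then have "(D - eps) * norm y \<le> norm (E *v x)"
    by (cases "norm y = 0") auto
  then show ?thesis using eps by (simp add: x_def y_def field_simps)
qed

end

lemma close_projection_of_kernel:
  assumes P: "orth_projection P" and Q: "orth_projection Q"
    and PQ: "\<And>u. norm (P *v u - Q *v (P *v u)) \<le> \<delta> * norm (P *v u)"
    and d: "0 \<le> \<delta>" and q: "Q *v q = 0"
  shows "norm (P *v q) \<le> \<delta> * norm q"
proof -
  have "(norm (P *v q))\<^sup>2 = q \<bullet> (P *v q - Q *v (P *v q))"
    using orth_projection_inner[OF Q, of q "P *v q"] q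
    by (simp add: orth_projection_norm[OF P] inner_diff_right)
  also have "\<dots> \<le> norm q * norm (P *v q - Q *v (P *v q))" by (rule norm_cauchy_schwarz)
  also have "\<dots> \<le> norm q * (\<delta> * norm (P *v q))" by (intro mult_left_mono PQ) simp
  finally have "norm (P *v q) * norm (P *v q) \<le> norm (P *v q) * (\<delta> * norm q)"
    by (simp add: power2_eq_square mult_ac)
  then show ?thesis using d by (cases "norm (P *v q) = 0") auto
qed

text \<open>Split \<open>q\<close> into \<open>Q q\<close>, which \<open>P\<close> nearly fixes, and \<open>q - Q q\<close>, which \<open>P\<close> nearly kills.\<close>

lemma close_projection_lower_bound:
  assumes P: "orth_projection P" and Q: "orth_projection Q" and d: "0 \<le> \<delta>"
    and PQ: "\<And>u. norm (P *v u - Q *v (P *v u)) \<le> \<delta> * norm (P *v u)"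
    and QP: "\<And>u. norm (Q *v u - P *v (Q *v u)) \<le> \<delta> * norm (Q *v u)"
  shows "(1 - \<delta>) * norm (Q *v q) - \<delta> * norm q \<le> norm (P *v q)"
proof -
  let ?r = "q - Q *v q"
  have "norm (P *v ?r) \<le> \<delta> * norm ?r"
    by (rule close_projection_of_kernel[OF P Q PQ d orth_projection_diff[OF Q]])
  also have "\<dots> \<le> \<delta> * norm q" by (intro mult_left_mono orth_projection_norm_le Q d)
  finally have r: "norm (P *v ?r) \<le> \<delta> * norm q" .
  have "P *v (Q *v q) = P *v q - P *v ?r" by (simp add: matrix_vector_mult_diff_distrib)
  then have "norm (P *v (Q *v q)) \<le> norm (P *v q) + \<delta> * norm q"
    using r norm_triangle_ineq4[of "P *v q" "P *v ?r"] by simp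
  moreover have "norm (Q *v q) \<le> norm (P *v (Q *v q)) + \<delta> * norm (Q *v q)"
    using QP[of q] norm_triangle_ineq[of "P *v (Q *v q)" "Q *v q - P *v (Q *v q)"] by simp
  ultimately show ?thesis by (simp add: algebra_simps)
qed

section \<open>The small eigenvalues of a perturbed Laplacian\<close>

lemma norm_le_op_norm: "norm (A *v u) \<le> op_norm A * norm u"
  unfolding op_norm_def by (rule onorm) simp

lemma op_norm_nonneg: "0 \<le> op_norm A"
  unfolding op_norm_def by (rule onorm_pos_le) simp

lemma norm_vec_square: "(norm v)\<^sup>2 = (\<Sum>i\<in>UNIV. (v $ i)\<^sup>2)" for v :: "real ^ 'n"
  by (simp add: norm_vec_def L2_set_def sum_nonneg)

lemma frobenius_columns: "(norm A)\<^sup>2 = (\<Sum>j\<in>UNIV. (norm (A *v axis j 1))\<^sup>2)"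
  for A :: "real ^ 'n ^ 'm"
  by (simp add: frobenius_eq_trace trace_def matrix_matrix_mult_def transpose_def norm_vec_square
      matrix_vector_mult_basis column_def flip: power2_eq_square)

lemma norm_transpose: "norm (transpose A) = norm A" for A :: "real ^ 'n ^ 'm"
  unfolding norm_eq_frobenius by (subst sum.swap) (simp add: transpose_def)

lemma op_norm_le_frobenius: "op_norm A \<le> norm A" for A :: "real ^ 'n ^ 'm"
  unfolding op_norm_def
proof (rule onorm_bound)
  fix u
  have "(norm (A *v u))\<^sup>2 = (\<Sum>i\<in>UNIV. (A $ i \<bullet> u)\<^sup>2)"
    by (simp add: norm_vec_square matrix_mult_dot)
  also have "\<dots> \<le> (\<Sum>i\<in>UNIV. (norm (A $ i) * norm u)\<^sup>2)"
    by (intro sum_mono abs_le_square_iff[THEN iffD1]) (simp add: Cauchy_Schwarz_ineq2)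
  also have "\<dots> = (norm A * norm u)\<^sup>2"
    by (simp add: power_mult_distrib norm_vec_def[of A] L2_set_def sum_nonneg sum_distrib_right)
  finally show "norm (A *v u) \<le> norm A * norm u" by (rule power2_le_imp_le) simp
qed simp

text \<open>The two bounds correspond to the two terms of the minimum in the Frobenius event: a projection does
  not increase the columns of \<open>E\<close>, and the squared Frobenius norm of a projection is its trace.\<close>

lemma frobenius_mult_projection_le:
  assumes Q: "orth_projection Q" and E: "transpose E = E"
  shows "norm (E ** Q) \<le> norm E"
    and "norm (E ** Q) \<le> sqrt (trace Q) * op_norm E"
proof -
  have "norm (E ** Q) = norm (Q ** E)"
    using norm_transpose[of "E ** Q"] Q E by (simp add: matrix_transpose_mul orth_projection_def)
  moreover have "(norm (Q ** E))\<^sup>2 \<le> (norm E)\<^sup>2"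
    unfolding frobenius_columns
    by (intro sum_mono power_mono)
      (simp_all add: orth_projection_norm_le[OF Q] flip: matrix_vector_mul_assoc)
  ultimately show "norm (E ** Q) \<le> norm E" using power2_le_imp_le[of "norm (Q ** E)" "norm E"] by simp
  have "(norm (E ** Q))\<^sup>2 \<le> (\<Sum>j\<in>UNIV. (op_norm E * norm (Q *v axis j 1))\<^sup>2)"
    unfolding frobenius_columns
    by (intro sum_mono power_mono) (simp_all add: norm_le_op_norm flip: matrix_vector_mul_assoc)
  also have "\<dots> = (op_norm E)\<^sup>2 * (norm Q)\<^sup>2"
    by (simp only: frobenius_columns power_mult_distrib sum_distrib_left)
  also have "(norm Q)\<^sup>2 = trace Q"
    using Q by (simp add: frobenius_eq_trace orth_projection_def)
  finally have "(norm (E ** Q))\<^sup>2 \<le> (sqrt (trace Q) * op_norm E)\<^sup>2"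
    by (simp add: power_mult_distrib trace_orth_projection[OF Q] mult.commute)
  then show "norm (E ** Q) \<le> sqrt (trace Q) * op_norm E"
    by (rule power2_le_imp_le) (simp add: op_norm_nonneg trace_orth_projection[OF Q])
qed

text \<open>The spectral gap as it is used below: a lower bound for the Laplacian on vectors with mean zero on
  every component.\<close>

definition component_gap :: "real ^ ('d::card2) upair \<Rightarrow> real \<Rightarrow> bool" where
  "component_gap x D \<longleftrightarrow>
     (\<forall>u. component_projection x *v u = 0 \<longrightarrow> D * (norm u)\<^sup>2 \<le> u \<bullet> (laplacian \<bar>x\<bar> *v u))"

lemma laplacian_eigenvalues_nonneg:
  assumes "orthonormal_eigensystem (laplacian \<bar>b\<bar>) V lam"
  shows "0 \<le> lam $ k"
  using laplacian_abs_psd[of "column k V" b] eigensystem_inner[OF assms, of k k]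
  by (simp add: eigensystem_eigenvector[OF assms])

text \<open>In the following \<open>x\<close> is the target, \<open>b\<close> the starting point of a step, \<open>Q\<close> projects onto the vectors
  that are constant on the components of \<open>x\<close>, and \<open>P\<close> onto the eigenvectors of the Laplacian of \<open>\<bar>b\<bar>\<close>
  whose eigenvalue is small.\<close>

context
  fixes x b :: "real ^ ('d::card2) upair" and V :: "real ^ ('d::card2) ^ ('d::card2)"
    and lam :: "real ^ ('d::card2)" and D eps :: real and E P Q :: "real ^ ('d::card2) ^ ('d::card2)"
  defines "E \<equiv> laplacian (\<bar>b\<bar> - \<bar>x\<bar>)"
    and "eps \<equiv> op_norm (laplacian (\<bar>b\<bar> - \<bar>x\<bar>))"
    and "Q \<equiv> component_projection x"
    and "P \<equiv> spectral_projection V {k. lam $ k \<le> op_norm (laplacian (\<bar>b\<bar> - \<bar>x\<bar>))}"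
  assumes es: "orthonormal_eigensystem (laplacian \<bar>b\<bar>) V lam"
    and gap: "component_gap x D"
    and small: "2 * op_norm (laplacian (\<bar>b\<bar> - \<bar>x\<bar>)) < D"
begin

lemma perturbed_laplacian:
  "orthonormal_eigensystem (laplacian \<bar>x\<bar> + E) V lam" "transpose (laplacian \<bar>x\<bar>) = laplacian \<bar>x\<bar>"
  "transpose E = E" "orth_projection Q" "laplacian \<bar>x\<bar> *v (Q *v u) = 0"
  "Q *v u = 0 \<Longrightarrow> D * (norm u)\<^sup>2 \<le> u \<bullet> (laplacian \<bar>x\<bar> *v u)"
  "norm (E *v u) \<le> eps * norm u" "0 \<le> eps" "eps < D" "2 * eps < D"
proof -
  show "orthonormal_eigensystem (laplacian \<bar>x\<bar> + E) V lam"
    using es by (simp add: E_def laplacian_diff)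
  show "laplacian \<bar>x\<bar> *v (Q *v u) = 0"
    unfolding Q_def by (intro laplacian_component_projection supported_on_within_components)
  show "Q *v u = 0 \<Longrightarrow> D * (norm u)\<^sup>2 \<le> u \<bullet> (laplacian \<bar>x\<bar> *v u)"
    using gap by (simp add: Q_def component_gap_def)
  show "0 \<le> eps" by (simp add: eps_def op_norm_nonneg)
  then show "eps < D" "2 * eps < D" using small by (simp_all add: eps_def)
qed (simp_all add: E_def Q_def eps_def transpose_laplacian orth_component_projection norm_le_op_norm)

lemma eps_D: "2 * eps / D < 1" "0 \<le> 2 * eps / D" "D / 2 \<le> D - eps" "0 < D"
  using perturbed_laplacian(8-10) by (simp_all add: field_simps)

lemma laplacian_eigenvalue_dichotomy: "lam $ k \<le> eps \<or> D - eps \<le> lam $ k"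
  by (rule perturbed_eigenvalue_dichotomy[OF perturbed_laplacian(1-9)])

lemma orth_projection_P: "orth_projection P"
  unfolding P_def by (rule orth_projection_spectral[OF es])

lemma small_eigenspace_near_components:
  "norm (P *v u - Q *v (P *v u)) \<le> 2 * eps / D * norm (P *v u)"
  by (rule small_eigenspace_near_kernel[OF perturbed_laplacian(1-9) laplacian_eigenvalues_nonneg[OF es]])
    (simp_all add: P_def eps_def)

lemma components_near_small_eigenspace:
  "norm (Q *v u - P *v (Q *v u)) \<le> norm (E *v (Q *v u)) / (D / 2)"
proof -
  have "norm (Q *v u - P *v (Q *v u)) \<le> norm (E *v (Q *v u)) / (D - eps)"
    by (rule kernel_near_small_eigenspace[OF perturbed_laplacian(1-9)]) (simp_all add: P_def eps_def)
  also have "\<dots> \<le> norm (E *v (Q *v u)) / (D / 2)"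
    using eps_D by (intro divide_left_mono mult_pos_pos) auto
  finally show ?thesis .
qed

text \<open>A vector of the small eigenspace with \<open>Q u = 0\<close> would be at distance \<open>\<parallel>u\<parallel>\<close> from its projection,
  but this distance is less than \<open>\<parallel>u\<parallel>\<close>.\<close>

lemma trace_small_eigenspace_le: "trace P \<le> trace Q"
proof (rule trace_orth_projection_mono[OF orth_projection_P perturbed_laplacian(4)])
  fix u assume u: "P *v u = u" "Q *v u = 0"
  then have "norm u \<le> 2 * eps / D * norm u"
    using small_eigenspace_near_components[of u] by simp
  then have "(1 - 2 * eps / D) * norm u \<le> 0" by (simp add: left_diff_distrib)
  then have "norm u \<le> 0" using eps_D(1) by (simp add: mult_le_0_iff)
  then show "u = 0" by simp
qed

lemma edge_near_component_projection:
  assumes "i \<noteq> j" and q: "q = axis i 1 - axis j 1"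
  shows "j \<in> component x i \<Longrightarrow> (norm (P *v q))\<^sup>2 \<le> 8 * (eps / D)\<^sup>2"
    and "(1 - 2 * eps / D) * norm (Q *v q) - 2 * eps / D * sqrt 2 \<le> norm (P *v q)"
proof -
  have nq: "norm q = sqrt 2"
    using norm_edge_vector[OF assms(1)] q by (metis norm_ge_zero real_sqrt_unique)
  {
    assume "j \<in> component x i"
    then have "Q *v q = 0" unfolding q Q_def by (rule component_projection_edge_within)
    then have "norm (P *v q) \<le> 2 * eps / D * sqrt 2"
      using close_projection_of_kernel[OF orth_projection_P perturbed_laplacian(4)
          small_eigenspace_near_components eps_D(2)] nq by metis
    then have "(norm (P *v q))\<^sup>2 \<le> (2 * eps / D * sqrt 2)\<^sup>2" by (rule power_mono) simp
    then show "(norm (P *v q))\<^sup>2 \<le> 8 * (eps / D)\<^sup>2"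
      by (simp add: power_mult_distrib power_divide)
  }
  have "norm (Q *v u - P *v (Q *v u)) \<le> 2 * eps / D * norm (Q *v u)" for u
  proof -
    have "norm (E *v (Q *v u)) / (D / 2) \<le> eps * norm (Q *v u) / (D / 2)"
      using eps_D perturbed_laplacian(7)[of "Q *v u"] by (intro divide_right_mono) auto
    then show ?thesis using components_near_small_eigenspace[of u] by (simp add: mult_ac)
  qed
  then show "(1 - 2 * eps / D) * norm (Q *v q) - 2 * eps / D * sqrt 2 \<le> norm (P *v q)"
    using close_projection_lower_bound[OF orth_projection_P perturbed_laplacian(4) eps_D(2)
        small_eigenspace_near_components] nq by metis
qed

text \<open>The direct bound for \<open>P - Q ** P\<close> would involve the squares of the small eigenvalues. The swapped
  residual \<open>Q - P ** Q\<close> involves only \<open>E\<close> on the range of \<open>Q\<close>.\<close>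

lemma frobenius_small_eigenspace: "norm (P - Q ** P) \<le> norm (E ** Q) / (D / 2)"
proof -
  have "(norm (P - Q ** P))\<^sup>2 \<le> (norm (Q - P ** Q))\<^sup>2"
    using frobenius_projection_swap[OF orth_projection_P perturbed_laplacian(4)]
      trace_small_eigenspace_le by simp
  also have "\<dots> \<le> (\<Sum>j\<in>UNIV. (norm ((E ** Q) *v axis j 1) / (D / 2))\<^sup>2)"
    unfolding frobenius_columns
    using components_near_small_eigenspace
    by (intro sum_mono power_mono) (simp_all add: matrix_vector_mult_diff_rdistrib flip: matrix_vector_mul_assoc)
  also have "\<dots> = (norm (E ** Q) / (D / 2))\<^sup>2"
    by (simp only: frobenius_columns power_divide sum_divide_distrib)
  finally show ?thesis by (rule power2_le_imp_le) (use eps_D(4) in simp)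
qed


lemma pair_weights_small_eigenspace:
  assumes "i \<noteq> j"
  shows "pair_weights V (\<chi> k. if lam $ k \<le> eps then 1 else 0) $ pair i j = (norm (P *v (axis i 1 - axis j 1)))\<^sup>2"
proof -
  have "pair_weights V (\<chi> k. if lam $ k \<le> eps then 1 else 0) $ pair i j
     = (\<Sum>k\<in>{k. lam $ k \<le> eps}. (column k V \<bullet> (axis i 1 - axis j 1))\<^sup>2)"
    unfolding pair_weights_eq_inner[OF assms]
    by (intro sum.mono_neutral_cong_right) auto
  then show ?thesis
    by (simp add: orth_projection_norm[OF orth_projection_P])
      (simp add: P_def eps_def spectral_projection_quadratic)
qed

text \<open>For a pair inside a component \<open>P (e\<^sub>i - e\<^sub>j)\<close> is the difference of two columns of \<open>P - P ** Q\<close>, the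
  transpose of the residual. Every column is used at most once for each vertex of its component in
  either role, so the sum is controlled by the squared Frobenius norm.\<close>

lemma sum_small_eigenspace_within:
  "(\<Sum>e\<in>within_components x. pair_weights V (\<chi> k. if lam $ k \<le> eps then 1 else 0) $ e)
     \<le> 4 * real (Max (card ` graph_components x)) * (norm (E ** Q) / (D / 2))\<^sup>2"
  (is "sum ?h _ \<le> _")
proof -
  define B where "B = transpose (P - Q ** P)"
  have B: "B *v u = P *v u - P *v (Q *v u)" for u
  proof -
    have "B = transpose P - transpose (Q ** P)"
      by (simp add: B_def transpose_def vec_eq_iff)
    then have "B = P - P ** Q"
      using orth_projection_P perturbed_laplacian(4)
      by (simp add: orth_projection_def matrix_transpose_mul)
    then show ?thesis by (simp add: matrix_vector_mult_diff_rdistrib matrix_vector_mul_assoc)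
  qed
  have "sum ?h (within_components x)
      \<le> 2 * real (Max (card ` graph_components x)) * (\<Sum>i\<in>UNIV. 2 * (norm (B *v axis i 1))\<^sup>2)"
  proof (rule sum_within_components_le)
    show "0 \<le> ?h e" for e
      by (cases e rule: pair_cases) (simp add: pair_weights_small_eigenspace)
    fix i j assume ij: "i \<noteq> j" "j \<in> component x i"
    have "Q *v (axis i 1 - axis j 1) = 0"
      unfolding Q_def using ij by (intro component_projection_edge_within)
    then have "?h (pair i j) = (norm (B *v axis i 1 - B *v axis j 1))\<^sup>2"
      using B[of "axis i 1 - axis j 1"]
      by (simp add: pair_weights_small_eigenspace ij matrix_vector_mult_diff_distrib)
    also have "\<dots> \<le> (norm (B *v axis i 1) + norm (B *v axis j 1))\<^sup>2"
      by (intro power_mono norm_triangle_ineq4) simp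
    also have "\<dots> \<le> 2 * (norm (B *v axis i 1))\<^sup>2 + 2 * (norm (B *v axis j 1))\<^sup>2"
      using sum_squares_bound[of "norm (B *v axis i 1)" "norm (B *v axis j 1)"]
      by (simp add: power2_sum)
    finally show "?h (pair i j) \<le> 2 * (norm (B *v axis i 1))\<^sup>2 + 2 * (norm (B *v axis j 1))\<^sup>2" .
  qed simp
  also have "(\<Sum>i\<in>UNIV. 2 * (norm (B *v axis i 1))\<^sup>2) = 2 * (norm B)\<^sup>2"
    by (simp only: frobenius_columns sum_distrib_left)
  also have "norm B = norm (P - Q ** P)" by (simp only: B_def norm_transpose)
  also have "2 * real (Max (card ` graph_components x)) * (2 * (norm (P - Q ** P))\<^sup>2)
      \<le> 2 * real (Max (card ` graph_components x)) * (2 * (norm (E ** Q) / (D / 2))\<^sup>2)"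
    using frobenius_small_eigenspace by (intro mult_left_mono power_mono) auto
  finally show ?thesis by simp
qed

text \<open>If \<open>b\<close> has no edges between components, the range of \<open>Q\<close> lies in the kernel of both Laplacians, so
  \<open>E\<close> vanishes on it and \<open>P\<close> contains it. The ranks do not allow \<open>P\<close> to be larger. The small
  eigenvalues are then exactly zero, so that all of them receive the same penalty derivative.\<close>

lemma small_eigenspace_eq_components:
  assumes b: "supported_on (within_components x) b"
  shows "P = Q" and "lam $ k \<le> eps \<Longrightarrow> lam $ k = 0"
proof -
  have "(laplacian \<bar>x\<bar> + E) *v (Q *v u) = 0" for u
    using laplacian_component_projection[OF b] by (simp add: E_def Q_def laplacian_diff)
  then have "E *v (Q *v u) = 0" for u
    by (simp add: matrix_vector_mult_add_rdistrib perturbed_laplacian(5))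
  then have "P *v (Q *v u) = Q *v u" for u
    using components_near_small_eigenspace[of u] by simp
  then show PQ: "P = Q"
    by (intro orth_projection_eqI orth_projection_P perturbed_laplacian(4) trace_small_eigenspace_le)
  assume k: "lam $ k \<le> eps"
  have "column k V = Q *v column k V"
  proof -
    have "P *v column k V = column k V"
      using k by (simp add: P_def eps_def spectral_projection_mult eigensystem_inner[OF es]
          if_distrib[of "\<lambda>a. a *\<^sub>R _"] cong: if_cong)
    then show ?thesis by (simp add: PQ)
  qed
  then have "laplacian \<bar>b\<bar> *v column k V = 0"
    using laplacian_component_projection[OF b] by (metis Q_def)
  then show "lam $ k = 0"
    using eigensystem_inner[OF es, of k k] by (auto simp: eigensystem_eigenvector[OF es])
qed

text \<open>The weights of a step are compared with those that give weight 1 to the small eigenvalues, which are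
  the quadratic form of \<open>P\<close>.\<close>

lemma pair_weights_sandwich:
  assumes small: "\<And>k. lam $ k \<le> eps \<Longrightarrow> L \<le> f (lam $ k) \<and> f (lam $ k) \<le> U"
    and large: "\<And>k. D - eps \<le> lam $ k \<Longrightarrow> f (lam $ k) = 0"
  shows "L * pair_weights V (\<chi> k. if lam $ k \<le> eps then 1 else 0) $ e \<le> pair_weights V (\<chi> k. f (lam $ k)) $ e"
    and "pair_weights V (\<chi> k. f (lam $ k)) $ e \<le> U * pair_weights V (\<chi> k. if lam $ k \<le> eps then 1 else 0) $ e"
proof -
  obtain i j where ij: "i \<noteq> j" "e = pair i j" by (rule pair_cases)
  have f: "f (lam $ k) = 0" if "\<not> lam $ k \<le> eps" for k
    using that large laplacian_eigenvalue_dichotomy[of k] by blast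
  show "L * pair_weights V (\<chi> k. if lam $ k \<le> eps then 1 else 0) $ e \<le> pair_weights V (\<chi> k. f (lam $ k)) $ e"
    unfolding ij(2) pair_weights_eq_inner[OF ij(1)] sum_distrib_left
    using small f by (intro sum_mono) (auto intro: mult_right_mono)
  show "pair_weights V (\<chi> k. f (lam $ k)) $ e \<le> U * pair_weights V (\<chi> k. if lam $ k \<le> eps then 1 else 0) $ e"
    unfolding ij(2) pair_weights_eq_inner[OF ij(1)] sum_distrib_left
    using small f by (intro sum_mono) (auto intro: mult_right_mono)
qed

text \<open>With \<open>s = sqrt (1 / dmax)\<close> the unperturbed norm is at least \<open>sqrt 2 * s\<close>, and the two error terms are
  each at most \<open>1/32\<close> of this, since \<open>2 * eps / D \<le> s / 32\<close>. So \<open>(15/16)\<^sup>2 * 2 / dmax\<close> remains.\<close>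

lemma edge_between_lower_bound:
  fixes dmax :: real
  assumes ij: "i \<noteq> j" "j \<notin> component x i"
    and dmax: "dmax = real (Max (card ` graph_components x))"
    and small: "eps / D \<le> 1 / 2 ^ 6 * sqrt (1 / dmax)"
  shows "1 / (2 * dmax) < (norm (P *v (axis i 1 - axis j 1)))\<^sup>2"
proof -
  let ?q = "axis i 1 - axis j 1 :: real ^ ('d::card2)"
  define s where "s = sqrt (1 / dmax)"
  have dmax1: "1 \<le> dmax"
    using card_component_le[of x i] card_component_pos[of x i] by (simp add: dmax)
  then have s: "0 < s" "s \<le> 1" "s\<^sup>2 = 1 / dmax" by (simp_all add: s_def)
  have eps: "0 \<le> 2 * eps / D" "2 * eps / D \<le> s / 32" using eps_D small by (simp_all add: s_def field_simps)
  have "(sqrt 2 * s)\<^sup>2 \<le> (norm (Q *v ?q))\<^sup>2"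
    using component_projection_edge_between[OF ij(2)] by (simp add: Q_def power_mult_distrib s dmax)
  then have Qq: "sqrt 2 * s \<le> norm (Q *v ?q)" by (rule power2_le_imp_le) simp
  have "31/32 * (sqrt 2 * s) \<le> (1 - 2 * eps / D) * norm (Q *v ?q)"
    using eps s Qq by (intro mult_mono) auto
  moreover have "2 * eps / D * sqrt 2 \<le> 1/32 * (sqrt 2 * s)"
    using mult_right_mono[OF eps(2), of "sqrt 2"] by (simp add: mult.commute)
  ultimately have "15/16 * (sqrt 2 * s) \<le> norm (P *v ?q)"
    using edge_near_component_projection(2)[OF ij(1) refl] by linarith
  then have "(15/16 * (sqrt 2 * s))\<^sup>2 \<le> (norm (P *v ?q))\<^sup>2" using s by (intro power_mono) auto
  moreover have "1 / (2 * dmax) < (15/16 * (sqrt 2 * s))\<^sup>2"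
    using dmax1 by (simp add: power_mult_distrib s power_divide) (simp add: field_simps)
  ultimately show ?thesis by simp
qed

end

section \<open>Penalty derivative and first-order optimality\<close>

lemma
  assumes g: "SCAD_like a0 a1 b1 b2 \<tau> g" and a: "a1 \<le> a0" "0 < a1"
  shows SCAD_like_tuning_nonneg: "0 \<le> \<tau>"
    and penalty_deriv_0: "penalty_deriv g 0 = a0 * \<tau>"
    and penalty_deriv_nonneg: "0 \<le> t \<Longrightarrow> 0 \<le> penalty_deriv g t"
    and penalty_deriv_upper: "0 \<le> t \<Longrightarrow> penalty_deriv g t \<le> a0 * \<tau>"
    and penalty_deriv_lower: "0 \<le> t \<Longrightarrow> t \<le> b1 * \<tau> \<Longrightarrow> a1 * \<tau> \<le> penalty_deriv g t"
    and penalty_deriv_flat: "0 < t \<Longrightarrow> b2 * \<tau> \<le> t \<Longrightarrow> penalty_deriv g t = 0"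
proof -
  have lim: "(deriv g \<longlongrightarrow> a0 * \<tau>) (at_right 0)" using g by (simp add: SCAD_like_def)
  have dg: "(g has_real_derivative deriv g t) (at t)" if "0 < t" for t
    using g that by (simp add: SCAD_like_def DERIV_deriv_iff_real_differentiable)
  have nonneg: "0 \<le> deriv g t" if "0 < t" for t
    using g dg[OF that] that
    by (intro mono_on_imp_deriv_nonneg[of "{0..}" g "deriv g t" t]) (auto simp: SCAD_like_def)
  \<comment> \<open>Adding the tangent inequalities of the concave function at \<open>s\<close> and at \<open>t\<close>.\<close>
  have antimono: "deriv g t \<le> deriv g s" if "0 < s" "s < t" for s t
  proof -
    have tangent: "- g y - (- g c) \<ge> - deriv g c * (y - c)" if "0 < c" "0 < y" for c y
    proof (rule convex_on_imp_above_tangent)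
      show "convex_on {0..} (\<lambda>x. - g x)" using g by (simp add: SCAD_like_def concave_on_def)
      show "((\<lambda>x. - g x) has_field_derivative - deriv g c) (at c within {0..})"
        using dg[OF that(1)] by (rule DERIV_minus[OF has_field_derivative_at_within])
    qed (use that in simp_all)
    have "(t - s) * (deriv g t - deriv g s) \<le> 0"
      using tangent[of s t] tangent[of t s] that by (simp add: algebra_simps)
    then show ?thesis using that by (simp add: mult_le_0_iff)
  qed
  have upper: "deriv g t \<le> a0 * \<tau>" if t: "0 < t" for t
  proof (rule tendsto_lowerbound[OF lim])
    have "\<forall>\<^sub>F s in at_right 0. s < t" using t by (simp add: eventually_at_right_less order_tendstoD[OF tendsto_ident_at])
    moreover have "\<forall>\<^sub>F s in at_right (0::real). 0 < s" by (rule eventually_at_right_less)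
    ultimately show "\<forall>\<^sub>F s in at_right 0. deriv g t \<le> deriv g s"
      by eventually_elim (rule antimono)
  qed simp
  have "0 \<le> a0 * \<tau>" using nonneg[of 1] upper[of 1] by simp
  then show tau: "0 \<le> \<tau>" using a by (simp add: zero_le_mult_iff)
  show pd0: "penalty_deriv g 0 = a0 * \<tau>"
    using tendsto_Lim[OF _ lim] by (simp add: penalty_deriv_def)
  show "0 \<le> penalty_deriv g t" "penalty_deriv g t \<le> a0 * \<tau>" if "0 \<le> t"
    using that nonneg[of t] upper[of t] pd0 \<open>0 \<le> a0 * \<tau>\<close>
    by (cases "t = 0"; simp add: penalty_deriv_def)+
  show "a1 * \<tau> \<le> penalty_deriv g t" if "0 \<le> t" "t \<le> b1 * \<tau>"
    using that g a tau pd0 by (cases "t = 0") (auto simp: penalty_deriv_def SCAD_like_def mult_right_mono)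
  show "penalty_deriv g t = 0" if "0 < t" "b2 * \<tau> \<le> t"
    using that g by (simp add: penalty_deriv_def SCAD_like_def)
qed

lemma has_derivative_gradient:
  fixes f :: "real ^ 'e \<Rightarrow> real"
  assumes "f differentiable (at x)"
  shows "(f has_derivative (\<lambda>h. gradient f x \<bullet> h)) (at x)"
proof -
  let ?D = "frechet_derivative f (at x)"
  have D: "(f has_derivative ?D) (at x)" using assms by (simp add: frechet_derivative_works)
  then have lin: "linear ?D" by (rule has_derivative_linear)
  have "?D h = gradient f x \<bullet> h" for h
  proof -
    have "?D h = ?D (\<Sum>e\<in>UNIV. h $ e *\<^sub>R axis e 1)"
      using basis_expansion[of h] by (simp add: scalar_mult_eq_scaleR)
    also have "\<dots> = (\<Sum>e\<in>UNIV. h $ e * ?D (axis e 1))"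
      by (simp add: linear_sum[OF lin] linear_cmul[OF lin])
    finally show ?thesis by (simp add: gradient_def inner_vec_def mult.commute)
  qed
  then have "?D = (\<lambda>h. gradient f x \<bullet> h)" by blast
  then show ?thesis using D by simp
qed

text \<open>Both optimality statements below come from a limit along a segment from the right, one
  from convexity and one from minimality.\<close>

lemma directional_derivative_gradient:
  fixes f :: "real ^ 'e \<Rightarrow> real"
  assumes "f differentiable (at x)"
  shows "((\<lambda>t. (f (x + t *\<^sub>R d) - f x) / t) \<longlongrightarrow> gradient f x \<bullet> d) (at_right 0)"
proof -
  have "((\<lambda>t. f (x + t *\<^sub>R d)) has_derivative (\<lambda>t. gradient f x \<bullet> (t *\<^sub>R d))) (at 0)"
    by (rule has_derivative_compose[where f = "\<lambda>t. x + t *\<^sub>R d" and g = f])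
      (auto intro!: derivative_eq_intros has_derivative_gradient assms)
  then have "((\<lambda>t. f (x + t *\<^sub>R d)) has_field_derivative gradient f x \<bullet> d) (at 0)"
    by (simp add: has_field_derivative_def mult_commute_abs)
  then have "((\<lambda>t. (f (x + t *\<^sub>R d) - f x) / t) \<longlongrightarrow> gradient f x \<bullet> d) (at 0)"
    by (simp add: has_field_derivative_iff)
  then show ?thesis by (rule filterlim_mono) (auto simp: at_le)
qed

lemma convex_gradient_inequality:
  fixes f :: "real ^ 'e \<Rightarrow> real"
  assumes convex: "convex_on UNIV f" and diff: "f differentiable (at x)"
  shows "f x + gradient f x \<bullet> (y - x) \<le> f y"
proof -
  have "gradient f x \<bullet> (y - x) \<le> f y - f x"
  proof (rule tendsto_upperbound[OF directional_derivative_gradient[OF diff]])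
    have "\<forall>\<^sub>F t in at_right (0::real). t < 1"
      by (rule order_tendstoD[OF tendsto_ident_at]) simp
    moreover have "\<forall>\<^sub>F t in at_right (0::real). 0 < t" by (rule eventually_at_right_less)
    ultimately show "\<forall>\<^sub>F t in at_right 0. (f (x + t *\<^sub>R (y - x)) - f x) / t \<le> f y - f x"
    proof eventually_elim
      case (elim t)
      have "f ((1 - t) *\<^sub>R x + t *\<^sub>R y) \<le> (1 - t) * f x + t * f y"
        using convex elim by (intro convex_onD) auto
      moreover have "(1 - t) *\<^sub>R x + t *\<^sub>R y = x + t *\<^sub>R (y - x)" by (simp add: algebra_simps)
      ultimately show ?case using elim by (simp add: field_simps)
    qed
  qed simp
  then show ?thesis by simp
qed

text \<open>Along the segment from \<open>\<beta>\<close> to \<open>\<gamma>\<close> the penalty grows at most linearly by convexity, so minimality of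
  \<open>\<beta>\<close> bounds the difference quotients of the loss from below.\<close>

lemma lasso_first_order_condition:
  fixes loss :: "real ^ 'e \<Rightarrow> real"
  assumes lasso: "lasso_block_oracle loss S w \<beta>" and w: "0 \<le> w"
    and diff: "loss differentiable (at \<beta>)" and \<gamma>: "supported_on S \<gamma>"
  shows "1/2 * (\<Sum>e\<in>S. w $ e * \<bar>\<beta> $ e\<bar>) \<le> gradient loss \<beta> \<bullet> (\<gamma> - \<beta>) + 1/2 * (\<Sum>e\<in>S. w $ e * \<bar>\<gamma> $ e\<bar>)"
proof -
  let ?pen = "\<lambda>\<beta>. 1/2 * (\<Sum>e\<in>S. w $ e * \<bar>\<beta> $ e\<bar>)"
  have \<beta>: "supported_on S \<beta>" and
    min: "\<And>\<beta>'. supported_on S \<beta>' \<Longrightarrow> loss \<beta> + ?pen \<beta> \<le> loss \<beta>' + ?pen \<beta>'"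
    using lasso by (auto simp: lasso_block_oracle_def is_arg_min_def not_less)
  have "?pen \<beta> - ?pen \<gamma> \<le> gradient loss \<beta> \<bullet> (\<gamma> - \<beta>)"
  proof (rule tendsto_lowerbound[OF directional_derivative_gradient[OF diff]])
    have "\<forall>\<^sub>F t in at_right (0::real). t < 1"
      by (rule order_tendstoD[OF tendsto_ident_at]) simp
    moreover have "\<forall>\<^sub>F t in at_right (0::real). 0 < t" by (rule eventually_at_right_less)
    ultimately show "\<forall>\<^sub>F t in at_right 0.
        ?pen \<beta> - ?pen \<gamma> \<le> (loss (\<beta> + t *\<^sub>R (\<gamma> - \<beta>)) - loss \<beta>) / t"
    proof eventually_elim
      case (elim t)
      have "?pen (\<beta> + t *\<^sub>R (\<gamma> - \<beta>)) \<le> 1/2 * (\<Sum>e\<in>S. w $ e * ((1 - t) * \<bar>\<beta> $ e\<bar> + t * \<bar>\<gamma> $ e\<bar>))"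
      proof (intro mult_left_mono sum_mono)
        fix e
        have "\<bar>(\<beta> + t *\<^sub>R (\<gamma> - \<beta>)) $ e\<bar> = \<bar>(1 - t) * \<beta> $ e + t * \<gamma> $ e\<bar>" by (simp add: algebra_simps)
        also have "\<dots> \<le> (1 - t) * \<bar>\<beta> $ e\<bar> + t * \<bar>\<gamma> $ e\<bar>"
          using abs_triangle_ineq[of "(1 - t) * \<beta> $ e" "t * \<gamma> $ e"] elim by (simp add: abs_mult)
        finally show "\<bar>(\<beta> + t *\<^sub>R (\<gamma> - \<beta>)) $ e\<bar> \<le> (1 - t) * \<bar>\<beta> $ e\<bar> + t * \<bar>\<gamma> $ e\<bar>" .
      qed (use w in \<open>auto simp: less_eq_vec_def\<close>)
      also have "\<dots> = (1 - t) * ?pen \<beta> + t * ?pen \<gamma>"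
        by (simp add: distrib_left sum.distrib sum_distrib_left mult_ac)
      also have "(1 - t) * p + t * q = p - t * (p - q)" for p q :: real
        by (simp add: algebra_simps)
      finally have "?pen (\<beta> + t *\<^sub>R (\<gamma> - \<beta>)) \<le> ?pen \<beta> - t * (?pen \<beta> - ?pen \<gamma>)" .
      moreover have "loss \<beta> + ?pen \<beta> \<le> loss (\<beta> + t *\<^sub>R (\<gamma> - \<beta>)) + ?pen (\<beta> + t *\<^sub>R (\<gamma> - \<beta>))"
        using \<beta> \<gamma> by (intro min) (simp add: supported_on_def)
      ultimately have "t * (?pen \<beta> - ?pen \<gamma>) \<le> loss (\<beta> + t *\<^sub>R (\<gamma> - \<beta>)) - loss \<beta>" by linarith
      then show ?case using elim by (simp only: pos_le_divide_eq mult.commute)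
    qed
  qed simp
  then show ?thesis by simp
qed

text \<open>The gradient inequality for the loss and the first-order condition inside \<open>S\<close> show that the
  objective at \<open>\<gamma>\<close> exceeds that at \<open>\<beta>\<close> by at least the sum over \<open>e \<notin> S\<close> of
  \<open>(m\<^sub>e / 2 - \<bar>gradient\<^sub>e\<bar>) * \<bar>\<gamma>\<^sub>e\<bar>\<close>. A minimizer therefore vanishes outside \<open>S\<close>, where the two problems
  have the same objective.\<close>

lemma lasso_block_solution_unique_minimizer:
  fixes loss :: "real ^ 'e \<Rightarrow> real"
  assumes convex: "convex_on UNIV loss" and diff: "loss differentiable (at \<beta>)"
    and m: "0 \<le> m" and w: "w = restrict_to S m"
    and lasso: "lasso_block_oracle loss S w \<beta>"
    and unique: "\<And>\<gamma>. lasso_block_oracle loss S w \<gamma> \<Longrightarrow> \<gamma> = \<beta>"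
    and dual: "\<And>e. e \<notin> S \<Longrightarrow> \<bar>gradient loss \<beta> $ e\<bar> < m $ e / 2"
  shows "is_arg_min (\<lambda>\<beta>. loss \<beta> + 1/2 * (\<Sum>e\<in>UNIV. m $ e * \<bar>\<beta> $ e\<bar>)) (\<lambda>_. True) \<gamma> \<longleftrightarrow> \<gamma> = \<beta>"
proof -
  let ?F = "\<lambda>\<beta>. loss \<beta> + 1/2 * (\<Sum>e\<in>UNIV. m $ e * \<bar>\<beta> $ e\<bar>)"
  let ?G = "\<lambda>\<beta>. loss \<beta> + 1/2 * (\<Sum>e\<in>S. w $ e * \<bar>\<beta> $ e\<bar>)"
  have w0: "0 \<le> w" using m by (simp add: w restrict_to_def less_eq_vec_def)
  have pen: "(\<Sum>e\<in>UNIV. m $ e * \<bar>\<gamma> $ e\<bar>) = (\<Sum>e\<in>S. w $ e * \<bar>\<gamma> $ e\<bar>) + (\<Sum>e\<in>-S. m $ e * \<bar>\<gamma> $ e\<bar>)" for \<gamma>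
    by (subst sum.Int_Diff[of UNIV _ S]) (auto simp: w restrict_to_def Compl_eq_Diff_UNIV intro!: sum.cong)
  have FG: "?F \<gamma> = ?G \<gamma>" if "supported_on S \<gamma>" for \<gamma>
    using that by (simp add: pen supported_on_def)
  have \<beta>: "supported_on S \<beta>" using lasso by (simp add: lasso_block_oracle_def is_arg_min_def)
  have excess: "?F \<beta> + (\<Sum>e\<in>-S. (m $ e / 2 - \<bar>gradient loss \<beta> $ e\<bar>) * \<bar>\<gamma> $ e\<bar>) \<le> ?F \<gamma>" for \<gamma>
  proof -
    define \<gamma>' where "\<gamma>' = restrict_to S \<gamma>"
    have "gradient loss \<beta> \<bullet> (\<gamma> - \<gamma>') = (\<Sum>e\<in>-S. gradient loss \<beta> $ e * \<gamma> $ e)"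
      unfolding inner_vec_def
      by (intro sum.mono_neutral_cong_right) (auto simp: \<gamma>'_def restrict_to_def)
    moreover have "- (\<Sum>e\<in>-S. \<bar>gradient loss \<beta> $ e\<bar> * \<bar>\<gamma> $ e\<bar>) \<le> (\<Sum>e\<in>-S. gradient loss \<beta> $ e * \<gamma> $ e)"
      unfolding sum_negf[symmetric]
      by (intro sum_mono) (simp add: abs_mult[symmetric] abs_le_D2 minus_le_iff)
    moreover have "(\<Sum>e\<in>S. w $ e * \<bar>\<gamma>' $ e\<bar>) = (\<Sum>e\<in>S. w $ e * \<bar>\<gamma> $ e\<bar>)"
      by (intro sum.cong) (auto simp: \<gamma>'_def restrict_to_def)
    moreover have "supported_on S \<gamma>'" by (simp add: \<gamma>'_def restrict_to_def supported_on_def)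
    note lasso_first_order_condition[OF lasso w0 diff this]
    moreover have "loss \<beta> + gradient loss \<beta> \<bullet> (\<gamma> - \<beta>) \<le> loss \<gamma>"
      by (rule convex_gradient_inequality[OF convex diff])
    moreover have "gradient loss \<beta> \<bullet> (\<gamma> - \<beta>) = gradient loss \<beta> \<bullet> (\<gamma>' - \<beta>) + gradient loss \<beta> \<bullet> (\<gamma> - \<gamma>')"
      by (simp add: inner_diff_right)
    moreover have "(\<Sum>e\<in>-S. (m $ e / 2 - \<bar>gradient loss \<beta> $ e\<bar>) * \<bar>\<gamma> $ e\<bar>)
        = 1/2 * (\<Sum>e\<in>-S. m $ e * \<bar>\<gamma> $ e\<bar>) - (\<Sum>e\<in>-S. \<bar>gradient loss \<beta> $ e\<bar> * \<bar>\<gamma> $ e\<bar>)"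
      by (simp add: left_diff_distrib sum_subtractf sum_distrib_left)
    ultimately show ?thesis using FG[OF \<beta>] pen[of \<gamma>] by (simp add: distrib_left)
  qed
  have terms: "0 \<le> (m $ e / 2 - \<bar>gradient loss \<beta> $ e\<bar>) * \<bar>\<gamma> $ e\<bar>" if "e \<in> -S" for e \<gamma>
    using dual[of e] that by (intro mult_nonneg_nonneg) auto
  have slack: "0 \<le> (\<Sum>e\<in>-S. (m $ e / 2 - \<bar>gradient loss \<beta> $ e\<bar>) * \<bar>\<gamma> $ e\<bar>)" for \<gamma>
    by (intro sum_nonneg terms)
  show ?thesis
  proof
    assume "\<gamma> = \<beta>"
    moreover have "?F \<beta> \<le> ?F \<gamma>" for \<gamma>
      using excess[of \<gamma>] slack[of \<gamma>] by linarith
    ultimately show "is_arg_min ?F (\<lambda>_. True) \<gamma>" by (simp add: is_arg_min_def not_less)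
  next
    assume "is_arg_min ?F (\<lambda>_. True) \<gamma>"
    then have F\<gamma>: "?F \<gamma> \<le> ?F \<beta>" by (simp add: is_arg_min_def not_less)
    then have "(\<Sum>e\<in>-S. (m $ e / 2 - \<bar>gradient loss \<beta> $ e\<bar>) * \<bar>\<gamma> $ e\<bar>) = 0"
      using excess[of \<gamma>] slack[of \<gamma>] by linarith
    then have zero: "\<forall>e\<in>-S. (m $ e / 2 - \<bar>gradient loss \<beta> $ e\<bar>) * \<bar>\<gamma> $ e\<bar> = 0"
      using terms by (subst (asm) sum_nonneg_eq_0_iff) auto
    have "\<gamma> $ e = 0" if "e \<notin> S" for e
      using bspec[OF zero, of e] dual[OF that] that by auto
    then have \<gamma>: "supported_on S \<gamma>" by (simp add: supported_on_def)
    have "?G \<gamma> \<le> ?G \<gamma>'" if "supported_on S \<gamma>'" for \<gamma>'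
    proof -
      have "?G \<beta> \<le> ?G \<gamma>'" using lasso that by (auto simp: lasso_block_oracle_def is_arg_min_def not_less)
      then show ?thesis using F\<gamma> FG[OF \<gamma>] FG[OF \<beta>] by linarith
    qed
    then have "lasso_block_oracle loss S w \<gamma>"
      using \<gamma> by (auto simp: lasso_block_oracle_def is_arg_min_def not_less)
    then show "\<gamma> = \<beta>" by (rule unique)
  qed
qed

section \<open>Weights of an LLA step\<close>

lemma infnorm_le:
  fixes v :: "real ^ 'e"
  assumes "\<And>e. \<bar>v $ e\<bar> \<le> c"
  shows "infnorm v \<le> c"
  unfolding infnorm_cart by (rule cSup_least) (use assms in auto)

lemma pair_weights_nonneg:
  assumes "\<And>k. 0 \<le> w $ k"
  shows "0 \<le> pair_weights V w $ e"
proof -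
  obtain i j where "i \<noteq> j" "e = pair i j" by (rule pair_cases)
  then show ?thesis using assms by (simp add: pair_weights_pair sum_nonneg)
qed

lemma LLA_weights_nonneg:
  assumes "SCAD_like a0 a1 b1 b2 \<tau> g" "a1 \<le> a0" "0 < a1"
    and es: "orthonormal_eigensystem (laplacian \<bar>b\<bar>) V lam"
  shows "0 \<le> pair_weights V (\<chi> k. penalty_deriv g (lam $ k))"
  using penalty_deriv_nonneg[OF assms(1-3)] laplacian_eigenvalues_nonneg[OF es]
  by (simp add: less_eq_vec_def pair_weights_nonneg)

lemma LLA_stepI:
  assumes "\<And>V lam \<gamma>. orthonormal_eigensystem (laplacian \<bar>b\<bar>) V lam \<Longrightarrow>
      is_arg_min (LLA_objective loss g V lam) (\<lambda>_. True) \<gamma> \<longleftrightarrow> \<gamma> = \<beta>"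
  shows "LLA_step loss g b \<beta>"
proof -
  obtain V lam where "orthonormal_eigensystem (laplacian \<bar>b\<bar>) V lam"
    using symmetric_matrix_eigensystem[OF transpose_laplacian] by blast
  then show ?thesis using assms unfolding LLA_step_def LLA_results_def by blast
qed

text \<open>The Laplacian of the target vanishes on the range of the component projection, whose rank is the
  number of components, so the gap of the ordered eigenvalues becomes a gap of the quadratic form.\<close>

lemma laplacian_gap:
  fixes x :: "real ^ ('d::card2) upair"
  assumes "x \<noteq> 0" "0 < D" "D \<le> nth_eigenvalue (laplacian \<bar>x\<bar>) (card (graph_components x) + 1)"
  shows "component_gap x D"
  unfolding component_gap_def
  by (intro allI impI, rule spectral_gap_quadratic_form[OF transpose_laplacian orth_component_projection
        laplacian_component_projection[OF supported_on_within_components]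
        trace_component_projection card_graph_components_less]) (use assms in auto)

context
  fixes loss :: "real ^ ('d::card2) upair \<Rightarrow> real" and x :: "real ^ 'd upair"
    and g :: "real \<Rightarrow> real" and a0 a1 b1 b2 \<tau> dmax :: real and S :: "'d upair set"
  assumes S_def: "S = within_components x"
    and dmax_def: "dmax = real (Max (card ` graph_components x))"
    and a: "a1 \<le> a0" "0 < a1" and b: "b1 < b2" "0 < b1" and tau: "0 < \<tau>"
    and g: "SCAD_like a0 a1 b1 b2 \<tau> g"
    and gap: "component_gap x ((b1 + b2) * \<tau>)"
begin

lemma max_component_ge_1: "1 \<le> dmax"
  using card_component_le[of x] card_component_pos[of x]
  by (simp add: dmax_def) (metis Suc_le_eq One_nat_def le_trans)

text \<open>The gap \<open>(b1 + b2) * \<tau>\<close> is chosen such that a perturbation below \<open>b1 * \<tau>\<close> keeps the small eigenvalues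
  in the steep part of the penalty and the others in its flat part.\<close>

lemma penalty_on_spectrum:
  assumes "orthonormal_eigensystem (laplacian \<bar>b\<bar>) V lam" "eps < b1 * \<tau>"
  shows "lam $ k \<le> eps \<Longrightarrow> a1 * \<tau> \<le> penalty_deriv g (lam $ k) \<and> penalty_deriv g (lam $ k) \<le> a0 * \<tau>"
    and "(b1 + b2) * \<tau> - eps \<le> lam $ k \<Longrightarrow> penalty_deriv g (lam $ k) = 0"
proof -
  show "lam $ k \<le> eps \<Longrightarrow> a1 * \<tau> \<le> penalty_deriv g (lam $ k) \<and> penalty_deriv g (lam $ k) \<le> a0 * \<tau>"
    using penalty_deriv_lower[OF g a] penalty_deriv_upper[OF g a]
      laplacian_eigenvalues_nonneg[OF assms(1), of k] assms(2) by simp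
  assume "(b1 + b2) * \<tau> - eps \<le> lam $ k"
  then have "b2 * \<tau> < lam $ k" using assms(2) by (simp add: distrib_right)
  moreover have "0 < b2 * \<tau>" using b tau by simp
  ultimately show "penalty_deriv g (lam $ k) = 0" by (intro penalty_deriv_flat[OF g a]) auto
qed

text \<open>The situation of the second and all later steps. The weights are exactly \<open>a0 * \<tau>\<close> times the quadratic
  form of the component projection.\<close>

lemma LLA_weights_supported:
  assumes es: "orthonormal_eigensystem (laplacian \<bar>b\<bar>) V lam" and supp: "supported_on S b"
    and close: "op_norm (laplacian (\<bar>b\<bar> - \<bar>x\<bar>)) < b1 * \<tau>"
  shows "e \<in> S \<Longrightarrow> pair_weights V (\<chi> k. penalty_deriv g (lam $ k)) $ e = 0"
    and "e \<notin> S \<Longrightarrow> a1 * \<tau> / (2 * dmax) < pair_weights V (\<chi> k. penalty_deriv g (lam $ k)) $ e"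
proof -
  have small: "2 * op_norm (laplacian (\<bar>b\<bar> - \<bar>x\<bar>)) < (b1 + b2) * \<tau>"
  proof -
    have "b1 * \<tau> < b2 * \<tau>" using b tau by simp
    then show ?thesis using close by (simp add: distrib_right)
  qed
  note ctx = es gap small
  have f: "lam $ k \<le> op_norm (laplacian (\<bar>b\<bar> - \<bar>x\<bar>)) \<Longrightarrow>
      a0 * \<tau> \<le> penalty_deriv g (lam $ k) \<and> penalty_deriv g (lam $ k) \<le> a0 * \<tau>" for k
    using small_eigenspace_eq_components(2)[OF ctx supp[unfolded S_def], of k] penalty_deriv_0[OF g a] by simp
  have W: "pair_weights V (\<chi> k. penalty_deriv g (lam $ k)) $ pair i j
      = a0 * \<tau> * (norm (component_projection x *v (axis i 1 - axis j 1)))\<^sup>2" if "i \<noteq> j" for i j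
    using pair_weights_sandwich[where f = "penalty_deriv g", OF ctx f penalty_on_spectrum(2)[OF es close], of "pair i j"]
    by (simp add: pair_weights_small_eigenspace[OF ctx that]
        small_eigenspace_eq_components(1)[OF ctx supp[unfolded S_def]])
  obtain i j where ij: "i \<noteq> j" "e = pair i j" by (rule pair_cases)
  show "pair_weights V (\<chi> k. penalty_deriv g (lam $ k)) $ e = 0" if "e \<in> S"
    using that by (simp add: ij W S_def pair_in_within_components component_projection_edge_within)
  assume "e \<notin> S"
  then have "2 / dmax \<le> (norm (component_projection x *v (axis i 1 - axis j 1)))\<^sup>2"
    using component_projection_edge_between[of j x i]
    by (simp add: ij S_def pair_in_within_components dmax_def)
  then have "a0 * \<tau> * (2 / dmax) \<le> a0 * \<tau> * (norm (component_projection x *v (axis i 1 - axis j 1)))\<^sup>2"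
    using a tau by (intro mult_left_mono) auto
  moreover have "a1 * \<tau> / (2 * dmax) < a0 * \<tau> * (2 / dmax)"
  proof -
    have "a1 * \<tau> \<le> a0 * \<tau>" "0 < a0 * \<tau>" using a tau by auto
    then have "a1 * \<tau> < 4 * (a0 * \<tau>)" by linarith
    then show ?thesis using max_component_ge_1 by (simp add: field_simps)
  qed
  ultimately show "a1 * \<tau> / (2 * dmax) < pair_weights V (\<chi> k. penalty_deriv g (lam $ k)) $ e"
    by (simp add: ij W)
qed

text \<open>The situation of the first step. The three terms of the minimum \<open>c\<close> serve three purposes: the bound
  by \<open>\<rho>\<close> makes the weights inside components small, the second term keeps the weights between
  components away from zero, and the third one makes the perturbation smaller than \<open>b1 * \<tau>\<close>.\<close>

lemma LLA_weights_initial: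
  fixes V lam b \<rho>
  defines "W \<equiv> pair_weights V (\<chi> k. penalty_deriv g (lam $ k))"
    and "c \<equiv> min (min \<rho> (1 / 2 ^ 6 * sqrt (a1 / (a0 * dmax)))) (b1 / (b1 + b2))"
  assumes es: "orthonormal_eigensystem (laplacian \<bar>b\<bar>) V lam"
    and close: "op_norm (laplacian (\<bar>b\<bar> - \<bar>x\<bar>)) < c * ((b1 + b2) * \<tau>)"
  shows "e \<notin> S \<Longrightarrow> a1 * \<tau> / (2 * dmax) < W $ e"
    and "e \<in> S \<Longrightarrow> W $ e \<le> 2 ^ 5 * a0 * \<tau> * \<rho>\<^sup>2"
    and "min (norm (laplacian (\<bar>b\<bar> - \<bar>x\<bar>)))
          (sqrt (real (card (graph_components x))) * op_norm (laplacian (\<bar>b\<bar> - \<bar>x\<bar>))) < c * ((b1 + b2) * \<tau>) \<Longrightarrow>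
        sum (($) W) S \<le> 2 ^ 4 * dmax * a0 * \<tau> * \<rho>\<^sup>2"
proof -
  define D where "D = (b1 + b2) * \<tau>"
  define E where "E = laplacian (\<bar>b\<bar> - \<bar>x\<bar>)"
  have D: "0 < D" using b tau by (simp add: D_def)
  have eps0: "0 \<le> op_norm E" by (rule op_norm_nonneg)
  have close: "op_norm E < c * D" using close by (simp add: D_def E_def)
  then have epsc: "op_norm E / D < c" using D by (simp add: field_simps)
  have c: "c \<le> \<rho>" "c \<le> 1 / 2 ^ 6 * sqrt (a1 / (a0 * dmax))" "c \<le> b1 / (b1 + b2)"
    unfolding c_def by (meson min.cobounded1 min.cobounded2 order_trans)+
  have "c * D \<le> b1 / (b1 + b2) * D" using c D by (intro mult_right_mono) auto
  also have "\<dots> = b1 * \<tau>" using b by (simp add: D_def)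
  finally have eps_b1: "op_norm E < b1 * \<tau>" using close by simp
  moreover have "b1 * \<tau> < b2 * \<tau>" using b tau by simp
  ultimately have small: "2 * op_norm (laplacian (\<bar>b\<bar> - \<bar>x\<bar>)) < (b1 + b2) * \<tau>"
    by (simp add: distrib_right E_def)
  note ctx = es gap small
  note sandwich = pair_weights_sandwich[where f = "penalty_deriv g", OF ctx penalty_on_spectrum(1,2)[OF es eps_b1[unfolded E_def]],
      folded W_def, folded E_def D_def]
  note small_weights = pair_weights_small_eigenspace[OF ctx, folded E_def]
  have a0: "0 < a0" "0 < a0 * \<tau>" "0 < a1 * \<tau>" using a tau by auto
  obtain i j where ij: "i \<noteq> j" "e = pair i j" by (rule pair_cases)
  show "a1 * \<tau> / (2 * dmax) < W $ e" if "e \<notin> S"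
  proof -
    have j: "j \<notin> component x i" using that by (simp add: ij S_def pair_in_within_components)
    have "c \<le> 1 / 2 ^ 6 * sqrt (1 / dmax)"
    proof -
      have "a1 / (a0 * dmax) \<le> 1 / dmax" using a a0 max_component_ge_1 by (simp add: field_simps)
      then show ?thesis using c(2) by (simp add: order_trans)
    qed
    then have "op_norm E / D \<le> 1 / 2 ^ 6 * sqrt (1 / dmax)" using epsc by linarith
    from edge_between_lower_bound[OF ctx ij(1) j dmax_def, folded E_def D_def, OF this]
    have "a1 * \<tau> * (1 / (2 * dmax)) < a1 * \<tau> * pair_weights V (\<chi> k. if lam $ k \<le> op_norm E then 1 else 0) $ e"
      using a0 by (intro mult_strict_left_mono) (simp_all add: ij small_weights)
    also have "\<dots> \<le> W $ e" by (rule sandwich(1))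
    finally show ?thesis by simp
  qed
  show "W $ e \<le> 2 ^ 5 * a0 * \<tau> * \<rho>\<^sup>2" if "e \<in> S"
  proof -
    have j: "j \<in> component x i" using that by (simp add: ij S_def pair_in_within_components)
    have "W $ e \<le> a0 * \<tau> * pair_weights V (\<chi> k. if lam $ k \<le> op_norm E then 1 else 0) $ e"
      by (rule sandwich(2))
    also have "\<dots> \<le> a0 * \<tau> * (8 * (op_norm E / D)\<^sup>2)"
      using edge_near_component_projection(1)[OF ctx ij(1) refl j, folded E_def D_def] a0
      by (intro mult_left_mono) (simp_all add: ij small_weights)
    also have "\<dots> \<le> a0 * \<tau> * (32 * \<rho>\<^sup>2)"
    proof -
      have "(op_norm E / D)\<^sup>2 \<le> \<rho>\<^sup>2" using eps0 D epsc c by (intro power_mono) auto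
      then have "8 * (op_norm E / D)\<^sup>2 \<le> 32 * \<rho>\<^sup>2" using zero_le_power2[of \<rho>] by linarith
      then show ?thesis using a0 by (intro mult_left_mono) auto
    qed
    finally show ?thesis by (simp add: mult_ac)
  qed
  assume cF: "min (norm (laplacian (\<bar>b\<bar> - \<bar>x\<bar>)))
    (sqrt (real (card (graph_components x))) * op_norm (laplacian (\<bar>b\<bar> - \<bar>x\<bar>))) < c * ((b1 + b2) * \<tau>)"
  have "norm (E ** component_projection x)
      \<le> min (norm E) (sqrt (real (card (graph_components x))) * op_norm E)"
    using frobenius_mult_projection_le[OF orth_component_projection, of E x]
    by (simp add: E_def transpose_laplacian trace_component_projection)
  also note cF[folded E_def D_def]
  also have "c * D \<le> \<rho> * D" using c D by (intro mult_right_mono) auto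
  finally have "norm (E ** component_projection x) / (D / 2) \<le> 2 * \<rho>"
    using D by (simp add: field_simps)
  then have "(norm (E ** component_projection x) / (D / 2))\<^sup>2 \<le> (2 * \<rho>)\<^sup>2"
    using D by (intro power_mono) auto
  then have "4 * dmax * (norm (E ** component_projection x) / (D / 2))\<^sup>2 \<le> 4 * dmax * (2 * \<rho>)\<^sup>2"
    using max_component_ge_1 by (intro mult_left_mono) auto
  then have "(\<Sum>e\<in>S. pair_weights V (\<chi> k. if lam $ k \<le> op_norm E then 1 else 0) $ e) \<le> 16 * dmax * \<rho>\<^sup>2"
    using sum_small_eigenspace_within[OF ctx, folded E_def D_def S_def dmax_def]
    by (simp add: power_mult_distrib)
  then have "a0 * \<tau> * (\<Sum>e\<in>S. pair_weights V (\<chi> k. if lam $ k \<le> op_norm E then 1 else 0) $ e)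
      \<le> a0 * \<tau> * (16 * dmax * \<rho>\<^sup>2)" using a0 by (intro mult_left_mono) auto
  moreover have "sum (($) W) S \<le> (\<Sum>e\<in>S. a0 * \<tau> * pair_weights V (\<chi> k. if lam $ k \<le> op_norm E then 1 else 0) $ e)"
    by (intro sum_mono sandwich(2))
  ultimately show "sum (($) W) S \<le> 2 ^ 4 * dmax * a0 * \<tau> * \<rho>\<^sup>2"
    by (simp add: mult_ac flip: sum_distrib_left)
qed

end

section \<open>Two-step convergence for a fixed loss\<close>

lemma lasso_block_oracle_0: "lasso_block_oracle loss S 0 \<beta> \<longleftrightarrow> block_oracle loss S \<beta>"
  by (simp add: lasso_block_oracle_def block_oracle_def)

text \<open>The admissible weights are a parameter \<open>Wt\<close>, so that the operator-norm and the Frobenius version are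
  instances of the same argument.\<close>

theorem LLA_two_step_convergence:
  fixes loss :: "real ^ ('d::card2) upair \<Rightarrow> real" and x b est :: "real ^ 'd upair"
    and Wt :: "(real ^ 'd upair) set" and dmax :: real
  assumes S_def: "S = within_components x"
    and dmax_def: "dmax = real (Max (card ` graph_components x))"
    and a: "a1 \<le> a0" "0 < a1" and b: "b1 < b2" "0 < b1" and tau: "0 < \<tau>"
    and g: "SCAD_like a0 a1 b1 b2 \<tau> g"
    and gap: "component_gap x ((b1 + b2) * \<tau>)"
    and convex: "convex_on UNIV loss" and diff: "\<And>\<beta>. loss differentiable (at \<beta>)"
    and est: "block_oracle loss S est"
    and lasso_unique: "\<And>w. 0 \<le> w \<Longrightarrow> supported_on S w \<Longrightarrow> \<exists>!\<beta>. lasso_block_oracle loss S w \<beta>"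
    and Wt0: "0 \<in> Wt"
    and init_within: "\<And>V lam. orthonormal_eigensystem (laplacian \<bar>b\<bar>) V lam \<Longrightarrow>
      restrict_to S (pair_weights V (\<chi> k. penalty_deriv g (lam $ k))) \<in> Wt"
    and init_between: "\<And>V lam e. orthonormal_eigensystem (laplacian \<bar>b\<bar>) V lam \<Longrightarrow> e \<notin> S \<Longrightarrow>
      a1 * \<tau> / (2 * dmax) < pair_weights V (\<chi> k. penalty_deriv g (lam $ k)) $ e"
    and grad: "\<And>w \<beta> e. 0 \<le> w \<Longrightarrow> supported_on S w \<Longrightarrow> w \<in> Wt \<Longrightarrow> lasso_block_oracle loss S w \<beta> \<Longrightarrow>
      e \<notin> S \<Longrightarrow> \<bar>gradient loss \<beta> $ e\<bar> \<le> a1 * \<tau> / (4 * dmax)"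
    and close: "\<And>w \<beta>. 0 \<le> w \<Longrightarrow> supported_on S w \<Longrightarrow> w \<in> Wt \<Longrightarrow> lasso_block_oracle loss S w \<beta> \<Longrightarrow>
      op_norm (laplacian (\<bar>\<beta>\<bar> - \<bar>x\<bar>)) < b1 * \<tau>"
  shows "LLA_converges_in_two_steps loss g b est"
proof -
  note ctx = S_def dmax_def a b tau g gap
  let ?W = "\<lambda>V lam. pair_weights V (\<chi> k. penalty_deriv g (lam $ k))"
  have step: "LLA_step loss g c \<beta>"
    if w: "w \<in> Wt" "lasso_block_oracle loss S w \<beta>"
      and within: "\<And>V lam. orthonormal_eigensystem (laplacian \<bar>c\<bar>) V lam \<Longrightarrow> restrict_to S (?W V lam) = w"
      and between: "\<And>V lam e. orthonormal_eigensystem (laplacian \<bar>c\<bar>) V lam \<Longrightarrow> e \<notin> S \<Longrightarrow>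
        a1 * \<tau> / (2 * dmax) < ?W V lam $ e" for c w \<beta>
  proof (rule LLA_stepI)
    fix V lam \<gamma> assume es: "orthonormal_eigensystem (laplacian \<bar>c\<bar>) V lam"
    have W: "0 \<le> ?W V lam" by (rule LLA_weights_nonneg[OF g a es])
    have ws: "0 \<le> w" "supported_on S w"
      using W within[OF es] by (auto simp: restrict_to_def supported_on_def less_eq_vec_def)
    show "is_arg_min (LLA_objective loss g V lam) (\<lambda>_. True) \<gamma> \<longleftrightarrow> \<gamma> = \<beta>"
      unfolding LLA_objective_def
    proof (rule lasso_block_solution_unique_minimizer[OF convex diff W within[OF es, symmetric] w(2)])
      show "\<gamma> = \<beta>" if "lasso_block_oracle loss S w \<gamma>" for \<gamma>
        using lasso_unique[OF ws] that w(2) by blast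
      show "\<bar>gradient loss \<beta> $ e\<bar> < ?W V lam $ e / 2" if "e \<notin> S" for e
        using grad[OF ws w that] between[OF es that] by simp
    qed
  qed
  \<comment> \<open>From any Lasso solution the step has zero weights inside \<open>S\<close>, and the Lasso problem with zero weights
    is the block oracle problem.\<close>
  have to_est: "LLA_step loss g \<beta> est"
    if "0 \<le> w" "supported_on S w" "w \<in> Wt" "lasso_block_oracle loss S w \<beta>" for w \<beta>
  proof (rule step[OF Wt0])
    show "lasso_block_oracle loss S 0 est" using est by (simp add: lasso_block_oracle_0)
    have supp: "supported_on S \<beta>" using that(4) by (simp add: lasso_block_oracle_def is_arg_min_def)
    note weights = LLA_weights_supported[OF ctx _ supp close[OF that]]
    show "restrict_to S (?W V lam) = 0" if "orthonormal_eigensystem (laplacian \<bar>\<beta>\<bar>) V lam" for V lam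
      using weights(1)[OF that] by (simp add: restrict_to_def vec_eq_iff)
    show "a1 * \<tau> / (2 * dmax) < ?W V lam $ e"
      if "orthonormal_eigensystem (laplacian \<bar>\<beta>\<bar>) V lam" "e \<notin> S" for V lam e
      using weights(2)[OF that] .
  qed
  obtain V0 lam0 where es0: "orthonormal_eigensystem (laplacian \<bar>b\<bar>) V0 lam0"
    using symmetric_matrix_eigensystem[OF transpose_laplacian] by blast
  define w1 where "w1 = restrict_to S (?W V0 lam0)"
  have w1: "0 \<le> w1" "supported_on S w1" "w1 \<in> Wt"
    using LLA_weights_nonneg[OF g a es0] init_within[OF es0]
    by (auto simp: w1_def restrict_to_def supported_on_def less_eq_vec_def)
  then obtain \<beta>1 where \<beta>1: "lasso_block_oracle loss S w1 \<beta>1" using lasso_unique by blast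
  have step1: "LLA_step loss g b \<beta>1"
    using pair_weights_unique[OF transpose_laplacian _ es0]
    by (intro step[OF w1(3) \<beta>1] init_between) (auto simp: w1_def)
  have est0: "lasso_block_oracle loss S 0 est" using est by (simp add: lasso_block_oracle_0)
  have step2: "LLA_step loss g \<beta>1 est" by (rule to_est[OF w1 \<beta>1])
  have step3: "LLA_step loss g est est"
    by (rule to_est[OF _ _ Wt0 est0]) (simp_all add: supported_on_def)
  define it where "it = (\<lambda>t::nat. if t = 0 then b else if t = 1 then \<beta>1 else est)"
  have "LLA_step loss g (it t) (it (Suc t))" for t
    using step1 step2 step3 by (cases t; cases "t - 1"; simp add: it_def)
  then show ?thesis
    unfolding LLA_converges_in_two_steps_def by (intro exI[of _ it]) (simp add: it_def)
qed

text \<open>Interpolation: the squared norm is at most the product of the maximum and the sum of the entries, here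
  \<open>2 ^ 5 * 2 ^ 4 = 2 ^ 9\<close>.\<close>

lemma F_weight_norms:
  fixes w :: "real ^ 'e"
  assumes w: "0 \<le> w" "\<And>e. w $ e \<le> 2 ^ 5 * m" "sum (($) w) UNIV \<le> 2 ^ 4 * d * m" and dm: "0 \<le> d" "0 \<le> m"
  shows "norm w \<le> 2 powr (9/2) * sqrt d * m"
proof -
  have "(norm w)\<^sup>2 \<le> (\<Sum>e\<in>UNIV. 2 ^ 5 * m * w $ e)"
    unfolding norm_vec_square
    using w(1,2) by (intro sum_mono) (auto simp: power2_eq_square less_eq_vec_def intro: mult_right_mono)
  also have "\<dots> = 2 ^ 5 * m * sum (($) w) UNIV" by (simp only: sum_distrib_left)
  also have "\<dots> \<le> 2 ^ 5 * m * (2 ^ 4 * d * m)" using w(3) dm by (intro mult_left_mono) auto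
  also have "\<dots> = 2 ^ 9 * d * m\<^sup>2" by (simp add: power2_eq_square)
  also have "\<dots> = (2 powr (9/2) * sqrt d * m)\<^sup>2"
  proof -
    have "(2 powr (9/2))\<^sup>2 = (2 :: real) powr 9"
      by (simp add: power2_eq_square flip: powr_add)
    also have "\<dots> = 2 ^ 9" by (simp flip: powr_realpow)
    finally show ?thesis using dm by (simp only: power_mult_distrib real_sqrt_pow2)
  qed
  finally show ?thesis by (rule power2_le_imp_le) (use dm in simp)
qed

lemma continuous_on_op_norm: "continuous_on UNIV (op_norm :: real ^ 'n ^ 'm \<Rightarrow> real)"
proof -
  have tri: "op_norm A \<le> op_norm B + norm (A - B)" for A B :: "real ^ 'n ^ 'm"
  proof -
    have "op_norm (B + (A - B)) \<le> op_norm B + op_norm (A - B)"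
      using onorm_triangle[of "(*v) B" "(*v) (A - B)"]
      by (simp add: op_norm_def matrix_vector_mult_add_rdistrib[symmetric])
    then show ?thesis using op_norm_le_frobenius[of "A - B"] by simp
  qed
  have "dist (op_norm A) (op_norm B) \<le> dist A B" for A B :: "real ^ 'n ^ 'm"
    using tri[of A B] tri[of B A] by (simp add: dist_real_def dist_norm norm_minus_commute abs_le_iff)
  then show ?thesis
    unfolding continuous_on_iff by (meson le_less_trans)
qed

lemma continuous_on_laplacian_abs_diff:
  "continuous_on UNIV (\<lambda>b. laplacian (\<bar>b\<bar> - \<bar>x\<bar>))"
proof -
  have "continuous_on UNIV (\<lambda>b. laplacian (\<bar>b\<bar> - \<bar>x\<bar>) $ i $ j)" for i j
    by (cases "i = j")
      (auto simp: laplacian_def diag_matrix_def adj_matrix_def matrix_vector_mult_def abs_vec_component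
        if_distrib[of "\<lambda>a. a * _"] sum.If_cases cong: if_cong intro!: continuous_intros)
  then have "continuous_on UNIV (\<lambda>b. \<chi> i j. laplacian (\<bar>b\<bar> - \<bar>x\<bar>) $ i $ j)"
    by (intro continuous_on_vec_lambda)
  then show ?thesis by simp
qed

section \<open>Two-step convergence with high probability\<close>

theorem corollary3p2:
  fixes M :: "'w measure"
    and loss :: "'w \<Rightarrow> real ^ ('d::card2) upair \<Rightarrow> real"
    and init block_est :: "'w \<Rightarrow> real ^ 'd upair"
    and target :: "real ^ 'd upair"
    and g :: "real \<Rightarrow> real"
    and a0 a1 b1 b2 \<tau> \<rho> C :: real
    and S :: "'d upair set" and K dmax :: nat
    and bad1_op bad2_op bad3_op bad1_F bad2_F bad3_F :: "'w set"
  defines "S \<equiv> within_components target"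
    and "K \<equiv> card (graph_components target)"
    and "dmax \<equiv> Max (card ` graph_components target)"
    and "C \<equiv> min (min \<rho> (1 / 2 ^ 6 * sqrt (a1 / (a0 * real dmax)))) (b1 / (b1 + b2)) * (b1 + b2)"
    and "bad1_op \<equiv> {\<omega> \<in> space M. op_norm (laplacian (\<bar>init \<omega>\<bar> - \<bar>target\<bar>)) \<ge> C * \<tau>}"
    and "bad2_op \<equiv> {\<omega> \<in> space M.
           (SUP \<beta> \<in> lasso_solutions_op (loss \<omega>) S a0 \<rho> \<tau>.
              ereal (infnorm (restrict_to (- S) (gradient (loss \<omega>) \<beta>))))
           > ereal (a1 * \<tau> / (4 * real dmax))}"
    and "bad3_op \<equiv> {\<omega> \<in> space M.
           (SUP \<beta> \<in> lasso_solutions_op (loss \<omega>) S a0 \<rho> \<tau>.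
              ereal (op_norm (laplacian (\<bar>\<beta>\<bar> - \<bar>target\<bar>))))
           \<ge> ereal (b1 * \<tau>)}"
    and "bad1_F \<equiv> {\<omega> \<in> space M.
           min (norm (laplacian (\<bar>init \<omega>\<bar> - \<bar>target\<bar>)))
               (sqrt (real K) * op_norm (laplacian (\<bar>init \<omega>\<bar> - \<bar>target\<bar>))) \<ge> C * \<tau>}"
    and "bad2_F \<equiv> {\<omega> \<in> space M.
           (SUP \<beta> \<in> lasso_solutions_F (loss \<omega>) S dmax a0 \<rho> \<tau>.
              ereal (infnorm (restrict_to (- S) (gradient (loss \<omega>) \<beta>))))
           > ereal (a1 * \<tau> / (4 * real dmax))}"
    and "bad3_F \<equiv> {\<omega> \<in> space M.
           (SUP \<beta> \<in> lasso_solutions_F (loss \<omega>) S dmax a0 \<rho> \<tau>.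
              ereal (op_norm (laplacian (\<bar>\<beta>\<bar> - \<bar>target\<bar>))))
           \<ge> ereal (b1 * \<tau>)}"
  assumes prob_space: "prob_space M"
    and random_loss: "\<And>\<beta>. (\<lambda>\<omega>. loss \<omega> \<beta>) \<in> borel_measurable M"
    and random_init: "init \<in> borel_measurable M"
    and events: "bad2_op \<in> sets M" "bad3_op \<in> sets M" "bad2_F \<in> sets M" "bad3_F \<in> sets M"
    and target_nonzero: "target \<noteq> 0"
    and constants: "a0 \<ge> a1" "a1 > 0" "b2 > b1" "b1 > 0"
    and penalty: "SCAD_like a0 a1 b1 b2 \<tau> g"
    and convex: "\<And>\<omega>. \<omega> \<in> space M \<Longrightarrow> convex_on UNIV (loss \<omega>)"
    and differentiable: "\<And>\<omega> \<beta>. \<omega> \<in> space M \<Longrightarrow> (loss \<omega>) differentiable (at \<beta>)"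
    and block_est: "\<And>\<omega>. \<omega> \<in> space M \<Longrightarrow> block_oracle (loss \<omega>) S (block_est \<omega>)"
    and block_est_unique:
      "\<And>\<omega> \<beta>. \<omega> \<in> space M \<Longrightarrow> block_oracle (loss \<omega>) S \<beta> \<Longrightarrow> \<beta> = block_est \<omega>"
    and block_est_gradient:
      "\<And>\<omega> e. \<omega> \<in> space M \<Longrightarrow> e \<in> S \<Longrightarrow> gradient (loss \<omega>) (block_est \<omega>) $ e = 0"
    and lasso_unique:
      "\<And>\<omega> w. \<omega> \<in> space M \<Longrightarrow> 0 \<le> w \<Longrightarrow> supported_on S w \<Longrightarrow>
         \<exists>!\<beta>. lasso_block_oracle (loss \<omega>) S w \<beta>"
    and rho: "\<rho> \<ge> 0"
    and gap: "nth_eigenvalue (laplacian \<bar>target\<bar>) (K + 1) \<ge> (b1 + b2) * \<tau>"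
  shows "(\<exists>E \<in> sets M.
            (\<forall>\<omega>\<in>E. LLA_converges_in_two_steps (loss \<omega>) g (init \<omega>) (block_est \<omega>)) \<and>
            measure M E \<ge> 1 - measure M bad1_op - measure M bad2_op - measure M bad3_op) \<and>
         (\<exists>E \<in> sets M.
            (\<forall>\<omega>\<in>E. LLA_converges_in_two_steps (loss \<omega>) g (init \<omega>) (block_est \<omega>)) \<and>
            measure M E \<ge> 1 - measure M bad1_F - measure M bad2_F - measure M bad3_F)"
proof -
  interpret prob_space M by (rule prob_space)
  define c where "c = min (min \<rho> (1 / 2 ^ 6 * sqrt (a1 / (a0 * real dmax)))) (b1 / (b1 + b2))"
  have C: "C * t = c * ((b1 + b2) * t)" for t by (simp add: C_def c_def mult.assoc)
  let ?E = "\<lambda>\<omega>. laplacian (\<bar>init \<omega>\<bar> - \<bar>target\<bar>)"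
  let ?W = "\<lambda>V lam. pair_weights V (\<chi> k. penalty_deriv g (lam $ k))"
  note tau0 = SCAD_like_tuning_nonneg[OF penalty constants(1,2)]
  have dmax: "real dmax = real (Max (card ` graph_components target))" by (simp add: dmax_def)
  have S: "S = within_components target" by (simp add: S_def)
  have K: "1 \<le> sqrt (real K)"
    by (simp add: K_def graph_components_eq Suc_le_eq card_gt_0_iff)

  \<comment> \<open>The strict bound on a norm is only possible if \<open>C * \<tau> > 0\<close>, which excludes the degenerate tuning
    parameter \<open>\<tau> = 0\<close>.\<close>
  have tau: "0 < \<tau>" and component_gap: "component_gap target ((b1 + b2) * \<tau>)"
    if "op_norm (?E \<omega>) < C * \<tau>" for \<omega>
  proof -
    have "\<tau> \<noteq> 0" using that op_norm_nonneg[of "?E \<omega>"] by auto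
    then show tau: "0 < \<tau>" using tau0 by simp
    have "0 < (b1 + b2) * \<tau>" using tau constants by simp
    then show "component_gap target ((b1 + b2) * \<tau>)"
      by (rule laplacian_gap[OF target_nonzero]) (use gap in \<open>simp add: K_def\<close>)
  qed

  \<comment> \<open>The argument for one outcome, with a set \<open>Wt\<close> of admissible weights and the set \<open>B\<close> of Lasso solutions
    for them.\<close>
  have converges: "LLA_converges_in_two_steps (loss \<omega>) g (init \<omega>) (block_est \<omega>)"
    if \<omega>: "\<omega> \<in> space M" and close: "op_norm (?E \<omega>) < C * \<tau>"
      and B: "B = {\<beta>. \<exists>w \<ge> 0. supported_on S w \<and> w \<in> Wt \<and> lasso_block_oracle (loss \<omega>) S w \<beta>}"
      and grad: "\<not> (SUP \<beta> \<in> B. ereal (infnorm (restrict_to (- S) (gradient (loss \<omega>) \<beta>))))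
         > ereal (a1 * \<tau> / (4 * real dmax))"
      and dist: "\<not> (SUP \<beta> \<in> B. ereal (op_norm (laplacian (\<bar>\<beta>\<bar> - \<bar>target\<bar>)))) \<ge> ereal (b1 * \<tau>)"
      and Wt: "0 \<in> Wt" "\<And>V lam. orthonormal_eigensystem (laplacian \<bar>init \<omega>\<bar>) V lam \<Longrightarrow> restrict_to S (?W V lam) \<in> Wt"
    for \<omega> B Wt
  proof (rule LLA_two_step_convergence[where Wt = Wt, OF S dmax constants(1,2,3,4) tau[OF close] penalty component_gap[OF close]
          convex[OF \<omega>] differentiable[OF \<omega>] block_est[OF \<omega>] lasso_unique[OF \<omega>] Wt])
    show "a1 * \<tau> / (2 * real dmax) < ?W V lam $ e"
      if "orthonormal_eigensystem (laplacian \<bar>init \<omega>\<bar>) V lam" "e \<notin> S" for V lam e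
      by (rule LLA_weights_initial(1)[OF S dmax constants(1,2,3,4) tau[OF close] penalty component_gap[OF close]
            that(1) close[unfolded C c_def] that(2)])
    fix w \<beta> assume w: "0 \<le> w" "supported_on S w" "w \<in> Wt" "lasso_block_oracle (loss \<omega>) S w \<beta>"
    then have \<beta>: "\<beta> \<in> B" by (auto simp: B)
    show "op_norm (laplacian (\<bar>\<beta>\<bar> - \<bar>target\<bar>)) < b1 * \<tau>"
    proof -
      have "ereal (op_norm (laplacian (\<bar>\<beta>\<bar> - \<bar>target\<bar>)))
          \<le> (SUP \<beta> \<in> B. ereal (op_norm (laplacian (\<bar>\<beta>\<bar> - \<bar>target\<bar>))))"
        by (rule SUP_upper[OF \<beta>])
      also have "\<dots> < ereal (b1 * \<tau>)" using dist by (simp only: not_le)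
      finally show ?thesis by simp
    qed
    show "\<bar>gradient (loss \<omega>) \<beta> $ e\<bar> \<le> a1 * \<tau> / (4 * real dmax)" if "e \<notin> S" for e
    proof -
      have "\<bar>gradient (loss \<omega>) \<beta> $ e\<bar> \<le> infnorm (restrict_to (- S) (gradient (loss \<omega>) \<beta>))"
        using component_le_infnorm_cart[of "restrict_to (- S) (gradient (loss \<omega>) \<beta>)" e] that
        by (simp add: restrict_to_def)
      also have "ereal \<dots> \<le> ereal (a1 * \<tau> / (4 * real dmax))"
        using order_trans[OF SUP_upper[OF \<beta>]] grad by (simp only: not_less)
      finally show ?thesis by simp
    qed
  qed

  have weight_le: "\<bar>restrict_to S (?W V lam) $ e\<bar> \<le> 2 ^ 5 * a0 * \<tau> * \<rho>\<^sup>2"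
    and weight_nonneg: "0 \<le> restrict_to S (?W V lam)"
    if close: "op_norm (?E \<omega>) < C * \<tau>" and es: "orthonormal_eigensystem (laplacian \<bar>init \<omega>\<bar>) V lam"
    for \<omega> V lam e
  proof -
    note ctx = S dmax constants(1,2,3,4) tau[OF close] penalty component_gap[OF close]
    have "0 \<le> ?W V lam" by (rule LLA_weights_nonneg[OF penalty constants(1,2) es])
    moreover have "0 \<le> a0 * \<tau> * \<rho>\<^sup>2" using constants tau0 by simp
    moreover note LLA_weights_initial(2)[OF ctx es close[unfolded C c_def], of e]
    ultimately show "\<bar>restrict_to S (?W V lam) $ e\<bar> \<le> 2 ^ 5 * a0 * \<tau> * \<rho>\<^sup>2"
      "0 \<le> restrict_to S (?W V lam)"
      by (simp_all add: restrict_to_def less_eq_vec_def mult_ac)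
  qed

  have converges_op: "LLA_converges_in_two_steps (loss \<omega>) g (init \<omega>) (block_est \<omega>)"
    if "\<omega> \<in> space M - (bad1_op \<union> bad2_op \<union> bad3_op)" for \<omega>
  proof (rule converges)
    show \<omega>: "\<omega> \<in> space M" and close: "op_norm (?E \<omega>) < C * \<tau>"
      using that by (auto simp: bad1_op_def)
    let ?Wt = "{w :: real ^ 'd upair. infnorm w \<le> 2 ^ 5 * a0 * \<tau> * \<rho>\<^sup>2}"
    show "lasso_solutions_op (loss \<omega>) S a0 \<rho> \<tau>
        = {\<beta>. \<exists>w \<ge> 0. supported_on S w \<and> w \<in> ?Wt \<and> lasso_block_oracle (loss \<omega>) S w \<beta>}"
      by (simp add: lasso_solutions_op_def)
    show "0 \<in> ?Wt" using constants tau0 by (simp add: infnorm_0)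
    show "restrict_to S (?W V lam) \<in> ?Wt"
      if "orthonormal_eigensystem (laplacian \<bar>init \<omega>\<bar>) V lam" for V lam
      using weight_le[OF close that] by (simp add: infnorm_le)
  qed (use that in \<open>auto simp: bad2_op_def bad3_op_def\<close>)

  have converges_F: "LLA_converges_in_two_steps (loss \<omega>) g (init \<omega>) (block_est \<omega>)"
    if "\<omega> \<in> space M - (bad1_F \<union> bad2_F \<union> bad3_F)" for \<omega>
  proof (rule converges)
    show \<omega>: "\<omega> \<in> space M" using that by simp
    have closeF: "min (norm (?E \<omega>)) (sqrt (real K) * op_norm (?E \<omega>)) < C * \<tau>"
      using that by (auto simp: bad1_F_def not_le)
    have "op_norm (?E \<omega>) \<le> min (norm (?E \<omega>)) (sqrt (real K) * op_norm (?E \<omega>))"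
      using op_norm_le_frobenius[of "?E \<omega>"] mult_right_mono[OF K op_norm_nonneg[of "?E \<omega>"]] by simp
    then show close: "op_norm (?E \<omega>) < C * \<tau>" using closeF by (rule le_less_trans)
    let ?Wt = "{w :: real ^ 'd upair. infnorm w \<le> 2 ^ 5 * a0 * \<tau> * \<rho>\<^sup>2 \<and>
      norm w \<le> 2 powr (9/2) * sqrt (real dmax) * a0 * \<tau> * \<rho>\<^sup>2 \<and>
      (\<Sum>e\<in>UNIV. \<bar>w $ e\<bar>) \<le> 2 ^ 4 * real dmax * a0 * \<tau> * \<rho>\<^sup>2}"
    show "lasso_solutions_F (loss \<omega>) S dmax a0 \<rho> \<tau>
        = {\<beta>. \<exists>w \<ge> 0. supported_on S w \<and> w \<in> ?Wt \<and> lasso_block_oracle (loss \<omega>) S w \<beta>}"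
      by (simp add: lasso_solutions_F_def conj_assoc)
    show "0 \<in> ?Wt" using constants tau0 by (simp add: infnorm_0)
    fix V lam assume es: "orthonormal_eigensystem (laplacian \<bar>init \<omega>\<bar>) V lam"
    let ?w = "restrict_to S (?W V lam)"
    define m where "m = a0 * \<tau> * \<rho>\<^sup>2"
    have m: "0 \<le> m" using constants tau0 by (simp add: m_def)
    have nonneg: "0 \<le> ?w" by (rule weight_nonneg[OF close es])
    have "sum (($) ?w) UNIV = sum (($) (?W V lam)) S"
      by (rule sum.mono_neutral_cong_right) (auto simp: restrict_to_def)
    also have "\<dots> \<le> 2 ^ 4 * real dmax * a0 * \<tau> * \<rho>\<^sup>2"
      by (rule LLA_weights_initial(3)[OF S dmax constants(1,2,3,4) tau[OF close] penalty component_gap[OF close]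
            es close[unfolded C c_def] closeF[unfolded C c_def K_def]])
    finally have sum: "sum (($) ?w) UNIV \<le> 2 ^ 4 * real dmax * a0 * \<tau> * \<rho>\<^sup>2" .
    have "norm ?w \<le> 2 powr (9/2) * sqrt (real dmax) * m"
    proof (rule F_weight_norms[OF nonneg])
      show "?w $ e \<le> 2 ^ 5 * m" for e
        using abs_le_D1[OF weight_le[OF close es, of e]] by (simp add: m_def mult.assoc)
      show "sum (($) ?w) UNIV \<le> 2 ^ 4 * real dmax * m" using sum by (simp add: m_def mult.assoc)
    qed (use m in auto)
    moreover have "(\<Sum>e\<in>UNIV. \<bar>?w $ e\<bar>) = sum (($) ?w) UNIV"
      using nonneg by (intro sum.cong) (auto simp: less_eq_vec_def)
    ultimately show "?w \<in> ?Wt"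
      using sum infnorm_le[OF weight_le[OF close es]] by (simp add: m_def mult.assoc)
  qed (use that in \<open>auto simp: bad2_F_def bad3_F_def\<close>)

  have E_meas: "(\<lambda>\<omega>. ?E \<omega>) \<in> borel_measurable M"
    using measurable_compose[OF random_init borel_measurable_continuous_onI[OF continuous_on_laplacian_abs_diff]] .
  have op_meas: "(\<lambda>\<omega>. op_norm (?E \<omega>)) \<in> borel_measurable M"
    using measurable_compose[OF E_meas borel_measurable_continuous_onI[OF continuous_on_op_norm]] .
  have bad1: "bad1_op \<in> sets M" "bad1_F \<in> sets M"
    unfolding bad1_op_def bad1_F_def using E_meas op_meas by measurable

  have union_bound: "space M - (A \<union> B \<union> D) \<in> sets M"
    "1 - measure M A - measure M B - measure M D \<le> measure M (space M - (A \<union> B \<union> D))"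
    if "A \<in> sets M" "B \<in> sets M" "D \<in> sets M" for A B D
  proof -
    have "measure M (A \<union> B \<union> D) \<le> measure M A + measure M B + measure M D"
      using measure_Un_le[of "A \<union> B" M D] measure_Un_le[of A M B] that by simp
    then show "1 - measure M A - measure M B - measure M D \<le> measure M (space M - (A \<union> B \<union> D))"
      using prob_compl[of "A \<union> B \<union> D"] that by simp
  qed (use that in auto)

  show ?thesis
    using converges_op converges_F union_bound[OF bad1(1) events(1,2)] union_bound[OF bad1(2) events(3,4)]
    by blast
qed

end
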